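(* Let $U:\mathbb{R}^d\to\mathbb{R}$ satisfy: (i) $U$ is twice continuously differentiable, $\nabla U(0)=0$, and $\sup_{x}\|\mathrm{D}^2U(x)\|\le \mathtt{L}$ for some $\mathtt{L}\ge0$; (ii) $U$ is three times continuously differentiable and $\sup_x\|\mathrm{D}^3U(x)\|\le \mathtt{M}$ for some $\mathtt{M}\ge 0$; (iii) there exist $\mathtt{m}>0$, $\mathtt{K}\ge 0$ such that $\mathrm{D}^2U(x)[y,y]\ge\mathtt{m}$ for all $\|x\|\ge\mathtt{K}$, $\|y\|=1$. Let $\bar\eta=\mathtt{m}/16$ and $V_{\bar\eta}(x)=\exp(\bar\eta\|x\|^2)$. Then there exist $\bar\Gamma>0$ and $\bar A_{\bar\eta}>0$ with $\pi(V_{\bar\eta})\le \bar A_{\bar\eta}$, such that for every $\bar\gamma\in(0,\bar\Gamma]$ there exist $C_{\bar\gamma}\ge0$ and $\rho_{\bar\gamma}\in[0,1)$ such that for all $x\in\mathbb{R}^d$, all $\gamma\in(0,\bar\gamma]$ and all $k\in\mathbb{N}$, $$\|\delta_xR_\gamma^k-\pi\|_{V_{\bar\eta}}\le C_{\bar\gamma}\rho_{\bar\gamma}^{\gamma k}\{V_{\bar\eta}(x)+\pi(V_{\bar\eta})\}.$$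
   Context: $\pi$ denotes the probability density proportional to $e^{-U}$ and the associated measure. For $\gamma>0$, $r_\gamma(x,y)=(4\pi\gamma)^{-d/2}\exp(-\|y-x+\gamma\nabla U(x)\|^2/(4\gamma))$, $\alpha_\gamma(x,y)=1\wedge\frac{\pi(y)r_\gamma(y,x)}{\pi(x)r_\gamma(x,y)}$, and the MALA kernel is $R_\gamma(x,A)=\int\mathbb{1}_A(y)\alpha_\gamma(x,y)r_\gamma(x,y)dy+\delta_x(A)\int\{1-\alpha_\gamma(x,y)\}r_\gamma(x,y)dy$. For $V\ge1$ measurable and a finite signed measure $\mu$, $\|\mu\|_V=\sup\{|\int f d\mu|:\sup_x|f(x)|/V(x)\le1\}$. *)

theory Defs
  imports "HOL-Analysis.Analysis" "HOL-Probability.Probability"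
begin

definition target :: "('a::euclidean_space \<Rightarrow> real) \<Rightarrow> 'a measure" where
  "target U = density lborel
     (\<lambda>x. ennreal (exp (- U x)) / (\<integral>\<^sup>+ y. ennreal (exp (- U y)) \<partial>lborel))"

definition mala_prop :: "('a::euclidean_space \<Rightarrow> 'a) \<Rightarrow> real \<Rightarrow> 'a \<Rightarrow> 'a \<Rightarrow> real" where
  "mala_prop gradU \<gamma> x y =
     (4 * pi * \<gamma>) powr (- real DIM('a) / 2)
     * exp (- (norm (y - x + \<gamma> *\<^sub>R gradU x))\<^sup>2 / (4 * \<gamma>))"

definition mala_acc :: "('a::euclidean_space \<Rightarrow> real) \<Rightarrow> ('a \<Rightarrow> 'a) \<Rightarrow> real \<Rightarrow> 'a \<Rightarrow> 'a \<Rightarrow> real" where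
  "mala_acc U gradU \<gamma> x y =
     min 1 ((exp (- U y) * mala_prop gradU \<gamma> y x) / (exp (- U x) * mala_prop gradU \<gamma> x y))"

definition mala_kernel :: "('a::euclidean_space \<Rightarrow> real) \<Rightarrow> ('a \<Rightarrow> 'a) \<Rightarrow> real \<Rightarrow> 'a \<Rightarrow> 'a measure" where
  "mala_kernel U gradU \<gamma> x = measure_of UNIV (sets borel)
     (\<lambda>A. (\<integral>\<^sup>+ y. indicator A y * ennreal (mala_acc U gradU \<gamma> x y * mala_prop gradU \<gamma> x y) \<partial>lborel)
          + indicator A x * (\<integral>\<^sup>+ y. ennreal ((1 - mala_acc U gradU \<gamma> x y) * mala_prop gradU \<gamma> x y) \<partial>lborel))"

fun mala_iter :: "('a::euclidean_space \<Rightarrow> real) \<Rightarrow> ('a \<Rightarrow> 'a) \<Rightarrow> real \<Rightarrow> nat \<Rightarrow> 'a \<Rightarrow> 'a measure" where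
  "mala_iter U gradU \<gamma> 0 x = return borel x"
| "mala_iter U gradU \<gamma> (Suc k) x = mala_iter U gradU \<gamma> k x \<bind> mala_kernel U gradU \<gamma>"

definition vnorm :: "('a::euclidean_space \<Rightarrow> real) \<Rightarrow> 'a measure \<Rightarrow> 'a measure \<Rightarrow> ereal" where
  "vnorm V \<mu> \<nu> =
     (if integrable \<mu> V \<and> integrable \<nu> V then
        (SUP f \<in> {f \<in> borel_measurable borel. \<forall>x. \<bar>f x\<bar> \<le> V x}.
           ereal \<bar>(\<integral>x. f x \<partial>\<mu>) - (\<integral>x. f x \<partial>\<nu>)\<bar>)
      else \<infinity>)"

end

theory Submission
  imports Defs
begin

text \<open>
  The proof combines a drift condition with a minorization over the unit of physical time, that is over
  \<open>n\<close> steps with \<open>1 \<le> n \<gamma> \<le> 2\<close>; Harris' theorem then gives a contraction per unit of time that does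
  not depend on \<open>\<gamma>\<close>.

  Drift.  Put \<open>h = y - x\<close>, \<open>\<xi> = h + \<gamma> \<nabla>U(x)\<close> and \<open>D = \<nabla>U(y) - \<nabla>U(x)\<close>.  The logarithm of the acceptance
  ratio equals \<open>U(x) - U(y) + \<langle>\<nabla>U(y), h\<rangle> - \<langle>D, \<xi>\<rangle>/2 - \<gamma> |D|^2/4\<close>.  Where \<open>U\<close> is strongly convex along the
  segment from \<open>x\<close> to \<open>y\<close>, the first three terms are at least \<open>m |h|^2/2\<close> and absorb the others up to a
  multiple of \<open>|\<xi>|^2\<close>; elsewhere \<open>|h|\<close> is controlled by \<open>|\<xi>|\<close> and \<open>\<gamma>\<close>.  Hence the rejection probability is
  \<open>O(\<gamma>)\<close> uniformly in \<open>x\<close>, which is negligible against the contraction of \<open>exp (\<eta> |x|^2)\<close> under the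
  unadjusted Langevin step for large \<open>|x|\<close>.

  Minorization.  Up to the factor \<open>exp ((U(x) - U(y))/2)\<close>, which telescopes along paths, the accepted
  moves have a symmetric density that dominates a Gaussian kernel with a quadratic potential of order
  \<open>\<gamma>\<close>.  Iterating this kernel explicitly over a unit of time keeps a lower bound that is uniform in \<open>\<gamma>\<close>.
\<close>

section \<open>Gaussian integrals\<close>

text \<open>The obstacle is uniformity in the step size. On bounded sets one transition moves mass
  only over a distance of order sqrt \<gamma> and leaves an atom at its starting point, so a
  one-step minorization by a fixed measure degenerates as \<gamma> tends to 0. Blocks with n
  \<gamma> between 1 and 2 avoid this: the lower end gives the Gaussian lower bound a spread of
  order one and at least halves the drift term, while the upper end keeps the accumulated losses,
  each of order \<gamma> per step, bounded. The length n depends on \<gamma>, but the minorizing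
  measure, the weight parameter \<beta> and the contraction factor per block do not. Hence a single
  pair C, \<rho> serves all small steps, and only the conversion from number of steps to physical
  time involves \<gamma>.\<close>

lemma nn_integral_gaussian_real:
  assumes "a > 0"
  shows "(\<integral>\<^sup>+t. ennreal (exp (- a * t\<^sup>2)) \<partial>lborel) = ennreal (sqrt (pi / a))"
proof -
  define \<sigma> where "\<sigma> = sqrt (1 / (2 * a))"
  have s: "\<sigma> > 0" "\<sigma>\<^sup>2 = 1 / (2 * a)"
    using assms by (auto simp: \<sigma>_def)
  interpret prob_space "density lborel (normal_density 0 \<sigma>)"
    by (rule prob_space_normal_density[OF s(1)])
  have e: "exp (- a * t\<^sup>2) = sqrt (pi / a) * normal_density 0 \<sigma> t" for t
    using assms by (simp add: normal_density_def s real_sqrt_divide field_simps)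
  have "(\<integral>\<^sup>+t. ennreal (exp (- a * t\<^sup>2)) \<partial>lborel)
      = (\<integral>\<^sup>+t. ennreal (sqrt (pi / a)) * ennreal (normal_density 0 \<sigma> t) \<partial>lborel)"
    by (simp only: e ennreal_mult[OF real_sqrt_ge_zero normal_density_nonneg] assms pi_ge_zero less_imp_le divide_nonneg_nonneg)
  also have "\<dots> = ennreal (sqrt (pi / a)) * (\<integral>\<^sup>+t. ennreal (normal_density 0 \<sigma> t) \<partial>lborel)"
    by (rule nn_integral_cmult) auto
  also have "(\<integral>\<^sup>+t. ennreal (normal_density 0 \<sigma> t) \<partial>lborel) = 1"
    using emeasure_space_1 by (simp add: emeasure_density)
  finally show ?thesis by simp
qed

lemma nn_integral_gaussian:
  fixes c :: "'a::euclidean_space"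
  assumes "a > 0"
  shows "(\<integral>\<^sup>+u. ennreal (exp (- a * (norm (u - c))\<^sup>2)) \<partial>lborel)
    = ennreal ((pi / a) powr (real DIM('a) / 2))"
proof -
  have n: "(norm u)\<^sup>2 = (\<Sum>b\<in>Basis. (u \<bullet> b)\<^sup>2)" for u :: 'a
    by (subst power2_norm_eq_inner, subst euclidean_inner) (simp add: power2_eq_square)
  have "(\<integral>\<^sup>+u. ennreal (exp (- a * (norm (u - c))\<^sup>2)) \<partial>lborel)
      = (\<integral>\<^sup>+u. ennreal (exp (- a * (norm (u - c))\<^sup>2)) \<partial>(distr lborel borel ((+) c)))"
    by (simp add: lborel_distr_plus)
  also have "\<dots> = (\<integral>\<^sup>+(u::'a). ennreal (exp (- a * (norm u)\<^sup>2)) \<partial>lborel)"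
    by (subst nn_integral_distr) auto
  also have "\<dots> = (\<integral>\<^sup>+(u::'a). (\<Prod>b\<in>Basis. ennreal (exp (- a * (u \<bullet> b)\<^sup>2))) \<partial>lborel)"
    by (simp add: n sum_distrib_left exp_sum prod_ennreal flip: sum_negf)
  also have "\<dots> = (\<Prod>b\<in>(Basis::'a set). \<integral>\<^sup>+t. ennreal (exp (- a * t\<^sup>2)) \<partial>lborel)"
    by (rule nn_integral_lborel_prod) auto
  also have "\<dots> = ennreal (sqrt (pi / a) ^ DIM('a))"
    using assms by (simp only: nn_integral_gaussian_real[OF assms] prod_constant) (simp add: ennreal_power)
  also have "sqrt (pi / a) ^ DIM('a) = (pi / a) powr (real DIM('a) / 2)"
    using assms by (simp add: powr_half_sqrt[symmetric] powr_realpow[symmetric] powr_powr)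
  finally show ?thesis .
qed

lemma gaussian_complete_square:
  fixes z c :: "'a::real_inner" and A B :: real
  assumes "A + B > 0"
  shows "A * (norm (z - c))\<^sup>2 + B * (norm z)\<^sup>2
    = (A + B) * (norm (z - (A / (A + B)) *\<^sub>R c))\<^sup>2 + A * B / (A + B) * (norm c)\<^sup>2"
proof -
  have e: "(norm (z - t *\<^sub>R c))\<^sup>2 = (norm z)\<^sup>2 - 2 * t * (z \<bullet> c) + t\<^sup>2 * (norm c)\<^sup>2" for t
    unfolding power2_norm_eq_inner
    by (simp add: inner_diff_left inner_diff_right inner_commute power2_eq_square algebra_simps)
  have "(norm (z - c))\<^sup>2 = (norm z)\<^sup>2 - 2 * (z \<bullet> c) + (norm c)\<^sup>2"
    using e[of 1] by simp
  moreover define t where "t = A / (A + B)"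
  moreover have "A = t * (A + B)" using assms by (simp add: t_def)
  ultimately show ?thesis
    unfolding times_divide_eq_left[symmetric] t_def[symmetric] e by algebra
qed

text \<open>Only the sum A + B has to be positive. The drift estimate takes B = -\<eta>, the growing
  weight V, and the minorization takes B \<ge> 0, a confining potential.\<close>

lemma nn_integral_gaussian_product:
  fixes c :: "'a::euclidean_space"
  assumes "A + B > 0"
  shows "(\<integral>\<^sup>+z. ennreal (exp (- (A * (norm (z - c))\<^sup>2 + B * (norm z)\<^sup>2))) \<partial>lborel)
    = ennreal (exp (- (A * B / (A + B) * (norm c)\<^sup>2)) * (pi / (A + B)) powr (real DIM('a) / 2))"
proof -
  have "(\<integral>\<^sup>+z. ennreal (exp (- (A * (norm (z - c))\<^sup>2 + B * (norm z)\<^sup>2))) \<partial>lborel)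
    = (\<integral>\<^sup>+z. ennreal (exp (- (A * B / (A + B) * (norm c)\<^sup>2)))
         * ennreal (exp (- (A + B) * (norm (z - (A / (A + B)) *\<^sub>R c))\<^sup>2)) \<partial>lborel)"
    by (subst gaussian_complete_square[OF assms])
       (simp flip: ennreal_mult exp_add, simp add: algebra_simps)
  also have "\<dots> = ennreal (exp (- (A * B / (A + B) * (norm c)\<^sup>2)))
     * ennreal ((pi / (A + B)) powr (real DIM('a) / 2))"
    by (subst nn_integral_cmult) (auto simp only: nn_integral_gaussian[OF assms], simp)
  finally show ?thesis
    by (simp add: ennreal_mult)
qed

section \<open>Harris' theorem\<close>

lemma integral_mono_measure_nonneg:
  fixes h :: "'a \<Rightarrow> real"
  assumes sets: "sets \<nu> = sets P" and le: "\<And>A. A \<in> sets P \<Longrightarrow> emeasure \<nu> A \<le> emeasure P A"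
    and h: "integrable P h" "\<And>x. x \<in> space P \<Longrightarrow> 0 \<le> h x"
  shows "integrable \<nu> h" "(\<integral>x. h x \<partial>\<nu>) \<le> (\<integral>x. h x \<partial>P)"
proof -
  have sp: "space \<nu> = space P" using sets by (rule sets_eq_imp_space_eq)
  have [measurable]: "h \<in> borel_measurable P" using h by auto
  have m: "h \<in> borel_measurable \<nu>" by (simp cong: measurable_cong_sets add: sets)
  have "\<nu> \<le> P"
    using le by (subst le_measure[OF sets]) (auto simp: le_fun_def sets emeasure_notin_sets)
  then have n: "(\<integral>\<^sup>+x. ennreal (h x) \<partial>\<nu>) \<le> (\<integral>\<^sup>+x. ennreal (h x) \<partial>P)"
    by (rule nn_integral_mono_measure[OF sets])
  have eq: "(\<integral>\<^sup>+x. ennreal (h x) \<partial>P) = ennreal (\<integral>x. h x \<partial>P)"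
    using h by (intro nn_integral_eq_integral) auto
  have fin: "(\<integral>\<^sup>+x. ennreal (h x) \<partial>\<nu>) < \<infinity>"
    using n eq by (metis ennreal_less_top infinity_ennreal_def order_le_less_trans)
  show i: "integrable \<nu> h"
    using m h(2) fin sp by (intro integrableI_nonneg) auto
  have "(\<integral>\<^sup>+x. ennreal (h x) \<partial>\<nu>) = ennreal (\<integral>x. h x \<partial>\<nu>)"
    using i h(2) sp by (intro nn_integral_eq_integral) auto
  then have "ennreal (\<integral>x. h x \<partial>\<nu>) \<le> ennreal (\<integral>x. h x \<partial>P)" using n eq by simp
  then show "(\<integral>x. h x \<partial>\<nu>) \<le> (\<integral>x. h x \<partial>P)"
    using h by (subst (asm) ennreal_le_iff) (auto intro!: integral_nonneg_AE)
qed

text \<open>By the hypothesis every f x - W x lies below every f y + W y, so the supremum of the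
  former separates the two families. This turns control of differences into a pointwise bound that
  can be integrated.\<close>

lemma oscillation_centre:
  fixes f W :: "'a \<Rightarrow> real"
  assumes "S \<noteq> {}" "\<And>x y. x \<in> S \<Longrightarrow> y \<in> S \<Longrightarrow> f x - f y \<le> W x + W y"
  obtains a where "\<And>x. x \<in> S \<Longrightarrow> \<bar>f x - a\<bar> \<le> W x"
proof
  fix x assume x: "x \<in> S"
  have bdd: "bdd_above ((\<lambda>x. f x - W x) ` S)"
    using assms(2)[OF _ x] by (intro bdd_aboveI2[where M = "f x + W x"]) (auto simp: algebra_simps)
  have "f x - W x \<le> (SUP x\<in>S. f x - W x)" by (rule cSUP_upper[OF x bdd])
  moreover have "(SUP x\<in>S. f x - W x) \<le> f x + W x"
    using assms(2)[OF _ x] by (intro cSUP_least[OF assms(1)]) (auto simp: algebra_simps)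
  ultimately show "\<bar>f x - (SUP x\<in>S. f x - W x)\<bar> \<le> W x" by linarith
qed

text \<open>Hairer and Mattingly's form of Harris' theorem: for the weight \<open>1 + \<beta> V\<close> with \<open>\<beta>\<close> small, far
  apart points contract by the drift condition and points in the centre by the minorization.\<close>

lemma harris_contraction:
  fixes V f :: "'a \<Rightarrow> real"
  assumes prob: "\<And>x. x \<in> space M \<Longrightarrow> prob_space (P x)"
    and sets: "\<And>x. x \<in> space M \<Longrightarrow> sets (P x) = sets M"
    and V: "\<And>x. x \<in> space M \<Longrightarrow> 0 \<le> V x"
    and intV: "\<And>x. x \<in> space M \<Longrightarrow> integrable (P x) V"
    and drift: "\<And>x. x \<in> space M \<Longrightarrow> (\<integral>y. V y \<partial>P x) \<le> V x / 2 + B"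
    and B: "B \<ge> 0"
    and sets\<nu>: "sets \<nu> = sets M"
    and minor: "\<And>x A. x \<in> space M \<Longrightarrow> V x \<le> 8 * (B + 1) \<Longrightarrow> A \<in> sets M \<Longrightarrow> emeasure \<nu> A \<le> emeasure (P x) A"
    and mass: "ennreal \<epsilon> \<le> emeasure \<nu> (space M)"
    and \<beta>: "0 < \<beta>" "\<beta> \<le> 1 / 4" "2 * \<beta> * (B + 1) \<le> \<epsilon>"
    and f: "f \<in> borel_measurable M"
    and c: "c \<ge> 0"
    and osc: "\<And>x y. x \<in> space M \<Longrightarrow> y \<in> space M \<Longrightarrow> f x - f y \<le> c * (2 + \<beta> * V x + \<beta> * V y)"
    and x: "x \<in> space M" and y: "y \<in> space M"
  shows "(\<integral>z. f z \<partial>P x) - (\<integral>z. f z \<partial>P y) \<le> (1 - \<beta>) * c * (2 + \<beta> * V x + \<beta> * V y)"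
proof -
  define W where "W = (\<lambda>x. c * (1 + \<beta> * V x))"
  obtain a where a: "\<And>x. x \<in> space M \<Longrightarrow> \<bar>f x - a\<bar> \<le> W x"
    by (rule oscillation_centre[of "space M" f W])
       (use x osc in \<open>auto simp: W_def algebra_simps\<close>)
  define g where "g = (\<lambda>x. f x - a)"
  have sp: "space (P z) = space M" if "z \<in> space M" for z
    using sets[OF that] by (rule sets_eq_imp_space_eq)
  have W: "integrable (P z) W" "(\<integral>u. W u \<partial>P z) \<le> c * (1 + \<beta> * (V z / 2 + B))" if z: "z \<in> space M" for z
  proof -
    interpret prob_space "P z" by (rule prob[OF z])
    show "integrable (P z) W" unfolding W_def using intV[OF z] by simp
    have "(\<integral>u. W u \<partial>P z) = c * (1 + \<beta> * (\<integral>u. V u \<partial>P z))"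
      unfolding W_def using intV[OF z] by (simp add: prob_space)
    also have "\<dots> \<le> c * (1 + \<beta> * (V z / 2 + B))"
      using drift[OF z] \<beta> c by (intro mult_left_mono add_left_mono) auto
    finally show "(\<integral>u. W u \<partial>P z) \<le> c * (1 + \<beta> * (V z / 2 + B))" .
  qed
  have gm: "g \<in> borel_measurable (P z)" if "z \<in> space M" for z
    using f sets[OF that] unfolding g_def by (simp cong: measurable_cong_sets)
  have g: "integrable (P z) g" "(\<integral>u. f u \<partial>P z) = (\<integral>u. g u \<partial>P z) + a" if z: "z \<in> space M" for z
  proof -
    interpret prob_space "P z" by (rule prob[OF z])
    have "AE u in P z. norm (g u) \<le> norm (W u)"
      using a sp[OF z] by (intro AE_I2) (fastforce simp: g_def intro: order_trans)
    then show i: "integrable (P z) g"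
      by (rule Bochner_Integration.integrable_bound[OF W(1)[OF z] gm[OF z]])
    have "(\<integral>u. f u \<partial>P z) = (\<integral>u. g u + a \<partial>P z)" by (simp add: g_def)
    also have "\<dots> = (\<integral>u. g u \<partial>P z) + a" using i by (simp add: prob_space)
    finally show "(\<integral>u. f u \<partial>P z) = (\<integral>u. g u \<partial>P z) + a" .
  qed
  have gW: "g z \<le> W z" "- g z \<le> W z" if "z \<in> space M" for z
    using a[OF that] by (auto simp: g_def)
  have Vxy: "0 \<le> V x" "0 \<le> V y" using V x y by auto
  define S where "S = V x + V y"
  have S0: "S \<ge> 0" using Vxy by (simp add: S_def)
  have "(\<integral>u. g u \<partial>P x) - (\<integral>u. g u \<partial>P y) \<le> c * ((1 - \<beta>) * (2 + \<beta> * S))"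
  \<comment> \<open>Since \<beta> \<le> 1/4, the threshold makes S (1/2 - \<beta>) at least 2 (B +
    1): the halving of S by the drift then pays for the two additive constants B and for the factor
    1 - \<beta> on the constant 2. Below it both points lie in the set where the minorization is
    available.\<close>
  proof (cases "S \<ge> 8 * (B + 1)")
    case True
    have "(\<integral>u. g u \<partial>P x) \<le> (\<integral>u. W u \<partial>P x)"
      using gW sp[OF x] by (intro integral_mono g W x) auto
    moreover have "(\<integral>u. - g u \<partial>P y) \<le> (\<integral>u. W u \<partial>P y)"
      using gW sp[OF y] by (intro integral_mono integrable_minus g W y) auto
    ultimately have "(\<integral>u. g u \<partial>P x) - (\<integral>u. g u \<partial>P y)
        \<le> c * (1 + \<beta> * (V x / 2 + B)) + c * (1 + \<beta> * (V y / 2 + B))"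
      using W(2)[OF x] W(2)[OF y] by simp
    also have "\<dots> = c * (2 + \<beta> * S / 2 + 2 * \<beta> * B)"
      by (simp add: S_def algebra_simps)
    also have "\<dots> \<le> c * ((1 - \<beta>) * (2 + \<beta> * S))"
    proof (rule mult_left_mono[OF _ c])
      have "2 * (B + 1) \<le> S * (1/2 - \<beta>)"
      proof -
        have "2 * (B + 1) \<le> S * (1/4)" using True by simp
        also have "\<dots> \<le> S * (1/2 - \<beta>)" using \<beta> S0 by (intro mult_left_mono) auto
        finally show ?thesis .
      qed
      then have "\<beta> * (2 * (B + 1)) \<le> \<beta> * (S * (1/2 - \<beta>))" using \<beta> by (intro mult_left_mono) auto
      then show "2 + \<beta> * S / 2 + 2 * \<beta> * B \<le> (1 - \<beta>) * (2 + \<beta> * S)"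
        by (simp add: algebra_simps)
    qed
    finally show ?thesis .
  next
    case False
    then have small: "V x \<le> 8 * (B + 1)" "V y \<le> 8 * (B + 1)" using Vxy by (auto simp: S_def)
    \<comment> \<open>The minorization is applied at x to W - g and at y to W + g, both nonnegative.
      They add up to 2 W \<ge> 2 c, so the common part \<nu> accounts for at least 2 c \<epsilon>,
      which is the gain over the drift bound.\<close>
    have 1: "integrable \<nu> (\<lambda>u. W u - g u)" "(\<integral>u. W u - g u \<partial>\<nu>) \<le> (\<integral>u. W u - g u \<partial>P x)"
      by (rule integral_mono_measure_nonneg[where P = "P x"];
          use gW sp x small minor sets sets\<nu> W g in \<open>auto\<close>)+
    have 2: "integrable \<nu> (\<lambda>u. W u + g u)" "(\<integral>u. W u + g u \<partial>\<nu>) \<le> (\<integral>u. W u + g u \<partial>P y)"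
      by (rule integral_mono_measure_nonneg[where P = "P y"];
          use gW(2) sp y small minor sets sets\<nu> W g in \<open>force\<close>)+
    have fin: "emeasure \<nu> (space M) \<le> 1"
      using minor[OF x small(1), of "space M"] prob[OF x] sp[OF x]
      by (metis prob_space.emeasure_space_1 sets.top)
    have sp\<nu>: "space \<nu> = space M" using sets\<nu> by (rule sets_eq_imp_space_eq)
    interpret \<nu>: finite_measure \<nu>
      using fin sp\<nu> by (intro finite_measureI) (auto simp: top_unique)
    have "\<epsilon> \<le> measure \<nu> (space \<nu>)"
      using mass by (simp add: \<nu>.emeasure_eq_measure sp\<nu>)
    then have "2 * c * \<epsilon> \<le> 2 * c * measure \<nu> (space \<nu>)"
      using c by (intro mult_left_mono) auto
    also have "\<dots> = (\<integral>u. 2 * c \<partial>\<nu>)" by simp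
    also have "\<dots> \<le> (\<integral>u. (W u - g u) + (W u + g u) \<partial>\<nu>)"
    proof (rule integral_mono)
      fix u assume "u \<in> space \<nu>"
      then have "c * 0 \<le> c * (\<beta> * V u)"
        using V \<beta> c sp\<nu> by (intro mult_left_mono) auto
      then show "2 * c \<le> (W u - g u) + (W u + g u)" by (simp add: W_def algebra_simps)
    qed (use Bochner_Integration.integrable_add[OF 1(1) 2(1)] in auto)
    also have "\<dots> = (\<integral>u. W u - g u \<partial>\<nu>) + (\<integral>u. W u + g u \<partial>\<nu>)"
      by (rule Bochner_Integration.integral_add[OF 1(1) 2(1)])
    also have "\<dots> \<le> (\<integral>u. W u - g u \<partial>P x) + (\<integral>u. W u + g u \<partial>P y)"
      using 1 2 by simp
    also have "\<dots> = (\<integral>u. W u \<partial>P x) - (\<integral>u. g u \<partial>P x) + (\<integral>u. W u \<partial>P y) + (\<integral>u. g u \<partial>P y)"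
      using W g x y by simp
    finally have "(\<integral>u. g u \<partial>P x) - (\<integral>u. g u \<partial>P y)
        \<le> c * (1 + \<beta> * (V x / 2 + B)) + c * (1 + \<beta> * (V y / 2 + B)) - 2 * c * \<epsilon>"
      using W(2)[OF x] W(2)[OF y] by simp
    also have "\<dots> = c * (2 + \<beta> * S / 2 + 2 * \<beta> * B - 2 * \<epsilon>)"
      by (simp add: S_def algebra_simps)
    also have "\<dots> \<le> c * ((1 - \<beta>) * (2 + \<beta> * S))"
    proof (rule mult_left_mono[OF _ c])
      have "0 \<le> (\<beta> * S) * (1/2 - \<beta>)" using \<beta> S0 by (intro mult_nonneg_nonneg) auto
      moreover have "0 \<le> 2 * \<beta> * (B + 1)" using \<beta> B by simp
      ultimately show "2 + \<beta> * S / 2 + 2 * \<beta> * B - 2 * \<epsilon> \<le> (1 - \<beta>) * (2 + \<beta> * S)"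
        using \<beta>(3) by (simp add: algebra_simps)
    qed
    finally show ?thesis .
  qed
  then show ?thesis
    using g(2)[OF x] g(2)[OF y] by (simp add: S_def algebra_simps)
qed

section \<open>The Metropolis-adjusted Langevin kernel\<close>

lemma mala_prop_pos: "\<gamma> > 0 \<Longrightarrow> 0 < mala_prop gradU \<gamma> x y"
  by (simp add: mala_prop_def)

lemma mala_acc_le_1: "mala_acc U gradU \<gamma> x y \<le> 1"
  by (simp add: mala_acc_def)

lemma mala_acc_nonneg: "\<gamma> > 0 \<Longrightarrow> 0 \<le> mala_acc U gradU \<gamma> x y"
  using mala_prop_pos[of \<gamma> gradU] by (simp add: mala_acc_def less_imp_le)

text \<open>The right-hand side is symmetric in x and y, so this is detailed balance for accepted
  moves. It yields invariance of the target and carries symmetric lower bounds through the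
  acceptance step.\<close>

lemma mala_acc_mult_prop:
  assumes "\<gamma> > 0"
  shows "exp (- U x) * (mala_acc U gradU \<gamma> x y * mala_prop gradU \<gamma> x y)
    = min (exp (- U x) * mala_prop gradU \<gamma> x y) (exp (- U y) * mala_prop gradU \<gamma> y x)"
proof -
  have m: "a * min 1 (b / a) = min a b" if "0 < a" for a b :: real
    using that by (simp add: min_def field_simps)
  have "0 < exp (- U x) * mala_prop gradU \<gamma> x y"
    using mala_prop_pos[OF assms, of gradU x y] by simp
  from m[OF this, of "exp (- U y) * mala_prop gradU \<gamma> y x"] show ?thesis
    unfolding mala_acc_def by (simp only: ac_simps)
qed

lemma nn_integral_mala_prop:
  fixes x :: "'a::euclidean_space"
  assumes "\<gamma> > 0"
  shows "(\<integral>\<^sup>+y. ennreal (mala_prop gradU \<gamma> x y) \<partial>lborel) = 1"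
proof -
  have "(\<integral>\<^sup>+y. ennreal (mala_prop gradU \<gamma> x y) \<partial>lborel)
    = (\<integral>\<^sup>+y. ennreal ((4 * pi * \<gamma>) powr (- real DIM('a) / 2))
        * ennreal (exp (- (1 / (4 * \<gamma>)) * (norm (y - (x - \<gamma> *\<^sub>R gradU x)))\<^sup>2)) \<partial>lborel)"
    by (simp add: mala_prop_def ennreal_mult algebra_simps)
  also have "\<dots> = ennreal ((4 * pi * \<gamma>) powr (- real DIM('a) / 2))
      * ennreal ((pi / (1 / (4 * \<gamma>))) powr (real DIM('a) / 2))"
    using assms by (subst nn_integral_cmult) (simp_all only: nn_integral_gaussian zero_less_divide_1_iff, simp_all)
  also have "\<dots> = 1"
    using assms by (simp flip: ennreal_mult powr_add add: mult.assoc mult.left_commute)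
  finally show ?thesis .
qed

locale mala_chain =
  fixes U :: "'a::euclidean_space \<Rightarrow> real" and gradU :: "'a \<Rightarrow> 'a" and \<gamma> :: real
  assumes U_measurable [measurable]: "U \<in> borel_measurable borel"
    and gradU_measurable [measurable]: "gradU \<in> borel_measurable borel"
    and step_pos: "\<gamma> > 0"
begin

abbreviation "r \<equiv> mala_prop gradU \<gamma>"
abbreviation "\<alpha> \<equiv> mala_acc U gradU \<gamma>"
abbreviation "N \<equiv> mala_kernel U gradU \<gamma>"
abbreviation "iter \<equiv> mala_iter U gradU \<gamma>"

definition rej :: "'a \<Rightarrow> ennreal" where
  "rej x = (\<integral>\<^sup>+y. ennreal ((1 - \<alpha> x y) * r x y) \<partial>lborel)"

lemma measurable_prop [measurable]:
  assumes [measurable]: "f \<in> M \<rightarrow>\<^sub>M borel" "g \<in> M \<rightarrow>\<^sub>M borel"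
  shows "(\<lambda>z. r (f z) (g z)) \<in> borel_measurable M"
  unfolding mala_prop_def by measurable

lemma measurable_acc [measurable]:
  assumes [measurable]: "f \<in> M \<rightarrow>\<^sub>M borel" "g \<in> M \<rightarrow>\<^sub>M borel"
  shows "(\<lambda>z. \<alpha> (f z) (g z)) \<in> borel_measurable M"
  unfolding mala_acc_def by measurable

lemma measurable_rej [measurable]: "rej \<in> borel_measurable borel"
  unfolding rej_def by measurable

lemma r_pos: "0 < r x y" and \<alpha>_nonneg: "0 \<le> \<alpha> x y" and \<alpha>_le_1: "\<alpha> x y \<le> 1"
  by (simp_all add: mala_prop_pos mala_acc_nonneg mala_acc_le_1 step_pos)

lemma accept_plus_rej: "(\<integral>\<^sup>+y. ennreal (\<alpha> x y * r x y) \<partial>lborel) + rej x = 1"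
proof -
  have e: "ennreal (\<alpha> x y * r x y) + ennreal ((1 - \<alpha> x y) * r x y) = ennreal (r x y)" for y
    using r_pos[of x y] \<alpha>_nonneg[of x y] \<alpha>_le_1[of x y]
    by (subst ennreal_plus[symmetric]) (auto simp: algebra_simps)
  have "(\<integral>\<^sup>+y. ennreal (\<alpha> x y * r x y) \<partial>lborel) + rej x
      = (\<integral>\<^sup>+y. ennreal (\<alpha> x y * r x y) + ennreal ((1 - \<alpha> x y) * r x y) \<partial>lborel)"
    unfolding rej_def by (subst nn_integral_add) auto
  then show ?thesis by (simp add: e nn_integral_mala_prop[OF step_pos])
qed

lemma sets_kernel [simp, measurable_cong]: "sets (N x) = sets borel"
  by (simp add: mala_kernel_def sets.sigma_sets_eq[of borel, simplified])

lemma space_kernel [simp]: "space (N x) = UNIV"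
  using sets_eq_imp_space_eq[OF sets_kernel] by simp

text \<open>\<open>measure_of\<close> returns the prescribed set function only once it is known to
  be countably additive; here it is the sum of a measure with density and a multiple of a Dirac
  mass.\<close>

lemma emeasure_kernel:
  assumes [measurable]: "A \<in> sets borel"
  shows "emeasure (N x) A
    = (\<integral>\<^sup>+y. indicator A y * ennreal (\<alpha> x y * r x y) \<partial>lborel) + indicator A x * rej x"
proof -
  define D where "D = density lborel (\<lambda>y. ennreal (\<alpha> x y * r x y))"
  define \<mu> where "\<mu> = (\<lambda>A. (\<integral>\<^sup>+y. indicator A y * ennreal (\<alpha> x y * r x y) \<partial>lborel) + indicator A x * rej x)"
  have \<mu>: "\<mu> B = emeasure D B + emeasure (return borel x) B * rej x" if "B \<in> sets borel" for B
    using that unfolding \<mu>_def D_def by (subst emeasure_density) (auto simp: mult.commute)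
  have ca: "countably_additive (sets borel) \<mu>"
  proof (rule countably_additiveI)
    fix F :: "nat \<Rightarrow> 'a set"
    assume F: "range F \<subseteq> sets borel" "disjoint_family F" "(\<Union>i. F i) \<in> sets borel"
    then have "(\<Sum>i. \<mu> (F i)) = (\<Sum>i. emeasure D (F i) + emeasure (return borel x) (F i) * rej x)"
      by (intro suminf_cong \<mu>) auto
    also have "\<dots> = (\<Sum>i. emeasure D (F i)) + (\<Sum>i. emeasure (return borel x) (F i)) * rej x"
      by (subst suminf_add[symmetric]) auto
    also have "\<dots> = \<mu> (\<Union>i. F i)"
      using F by (subst (1 2) suminf_emeasure) (auto simp: \<mu> D_def)
    finally show "(\<Sum>i. \<mu> (F i)) = \<mu> (\<Union>i. F i)" .
  qed
  have "emeasure (N x) A = \<mu> A"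
  proof (rule emeasure_measure_of)
    show "N x = measure_of UNIV (sets borel) \<mu>"
      by (simp add: mala_kernel_def \<mu>_def rej_def)
  qed (use ca in \<open>auto simp: positive_def \<mu>_def\<close>)
  then show ?thesis by (simp add: \<mu>_def)
qed

lemma nn_integral_kernel:
  assumes f: "f \<in> borel_measurable borel"
  shows "(\<integral>\<^sup>+y. f y \<partial>N x) = (\<integral>\<^sup>+y. f y * ennreal (\<alpha> x y * r x y) \<partial>lborel) + f x * rej x"
  using f
proof (induction rule: borel_measurable_induct)
  case (cong f g)
  then have "f = g" by auto
  then show ?case using cong by simp
next
  case (set A)
  then show ?case by (subst nn_integral_indicator) (auto simp: emeasure_kernel)
next
  case (mult u c)
  then show ?case
    by (simp add: nn_integral_cmult mult.assoc distrib_left)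
next
  case (add u v)
  then show ?case
    by (simp add: nn_integral_add distrib_right ac_simps)
next
  case (seq F)
  have [measurable]: "F i \<in> borel_measurable borel" for i using seq by auto
  have "(\<integral>\<^sup>+y. (SUP i. F i) y \<partial>N x) = (SUP i. \<integral>\<^sup>+y. F i y \<partial>N x)"
    unfolding SUP_apply using seq(3) by (intro nn_integral_monotone_convergence_SUP) auto
  also have "\<dots> = (SUP i. (\<integral>\<^sup>+y. F i y * ennreal (\<alpha> x y * r x y) \<partial>lborel) + F i x * rej x)"
    using seq by simp
  also have "\<dots> = (SUP i. \<integral>\<^sup>+y. F i y * ennreal (\<alpha> x y * r x y) \<partial>lborel) + (SUP i. F i x * rej x)"
    using seq(3)
    by (intro ennreal_SUP_add)
       (auto simp: incseq_def le_fun_def intro!: nn_integral_mono mult_right_mono)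
  also have "(SUP i. F i x * rej x) = (SUP i. F i) x * rej x"
    by (simp only: SUP_apply SUP_mult_right_ennreal)
  also have "(SUP i. \<integral>\<^sup>+y. F i y * ennreal (\<alpha> x y * r x y) \<partial>lborel)
      = (\<integral>\<^sup>+y. (SUP i. F i y * ennreal (\<alpha> x y * r x y)) \<partial>lborel)"
    using seq(3)
    by (intro nn_integral_monotone_convergence_SUP[symmetric])
       (auto simp: incseq_def le_fun_def intro!: mult_right_mono)
  also have "\<dots> = (\<integral>\<^sup>+y. (SUP i. F i) y * ennreal (\<alpha> x y * r x y) \<partial>lborel)"
    by (simp only: SUP_apply SUP_mult_right_ennreal)
  finally show ?case .
qed

lemma prob_space_kernel: "prob_space (N x)"
  using accept_plus_rej[of x] emeasure_kernel[of UNIV x] by (intro prob_spaceI) simp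

lemma measurable_kernel: "N \<in> borel \<rightarrow>\<^sub>M prob_algebra borel"
proof (rule measurable_prob_algebraI[OF prob_space_kernel measurable_subprob_algebra])
  fix A :: "'a set" assume [measurable]: "A \<in> sets borel"
  show "(\<lambda>x. emeasure (N x) A) \<in> borel_measurable borel"
    by (simp add: emeasure_kernel)
qed (auto intro: prob_space_imp_subprob_space prob_space_kernel)

lemma measurable_iter: "iter k \<in> borel \<rightarrow>\<^sub>M prob_algebra borel"
proof (induction k)
  case 0
  have "iter 0 = return borel" by (rule ext) simp
  then show ?case by simp
next
  case (Suc k)
  have "iter (Suc k) = (\<lambda>x. iter k x \<bind> N)" by (rule ext) simp
  then show ?case using measurable_bind_prob_space[OF Suc measurable_kernel] by simp
qed

lemma prob_space_iter: "prob_space (iter k x)"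
  and sets_iter [simp, measurable_cong]: "sets (iter k x) = sets borel"
  using measurable_space[OF measurable_iter, of x k] by (auto simp: space_prob_algebra)

lemma space_iter [simp]: "space (iter k x) = UNIV"
  using sets_eq_imp_space_eq[OF sets_iter] by simp

lemma measurable_nn_integral_kernel [measurable]:
  "f \<in> borel_measurable borel \<Longrightarrow> (\<lambda>x. \<integral>\<^sup>+y. f y \<partial>N x) \<in> borel_measurable borel"
  by (rule nn_integral_measurable_subprob_algebra2[where N = borel])
     (auto intro: measurable_prob_algebraD measurable_kernel)

lemma nn_integral_iter_Suc:
  assumes "f \<in> borel_measurable borel"
  shows "(\<integral>\<^sup>+y. f y \<partial>iter (Suc k) x) = (\<integral>\<^sup>+z. \<integral>\<^sup>+y. f y \<partial>N z \<partial>iter k x)"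
proof -
  have "N \<in> iter k x \<rightarrow>\<^sub>M subprob_algebra borel"
    using measurable_prob_algebraD[OF measurable_kernel] by (simp cong: measurable_cong_sets)
  then show ?thesis using nn_integral_bind[OF assms] by simp
qed

section \<open>Reversibility and invariance of the target\<close>

lemma nn_integral_target:
  assumes [measurable]: "f \<in> borel_measurable borel"
  shows "(\<integral>\<^sup>+x. f x \<partial>target U)
    = (\<integral>\<^sup>+x. (ennreal (exp (- U x)) / (\<integral>\<^sup>+ y. ennreal (exp (- U y)) \<partial>lborel)) * f x \<partial>lborel)"
  unfolding target_def by (subst nn_integral_density) auto

text \<open>For the accepted part, Fubini together with \<open>sym\<close> exchanges the two
  endpoints; the rejected part sits on the diagonal and is unaffected. The two masses then recombine
  to 1 by \<open>accept_plus_rej\<close>.\<close>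

lemma target_invariant:
  assumes [measurable]: "f \<in> borel_measurable borel"
  shows "(\<integral>\<^sup>+x. \<integral>\<^sup>+y. f y \<partial>N x \<partial>target U) = (\<integral>\<^sup>+x. f x \<partial>target U)"
proof -
  define w where "w = (\<lambda>x. ennreal (exp (- U x)) / (\<integral>\<^sup>+ y. ennreal (exp (- U y)) \<partial>lborel))"
  define p where "p = (\<lambda>x y. ennreal (\<alpha> x y * r x y))"
  have [measurable]: "w \<in> borel_measurable borel" unfolding w_def by measurable
  have pm [measurable]: "(\<lambda>z. p (f z) (g z)) \<in> borel_measurable M"
    if [measurable]: "f \<in> M \<rightarrow>\<^sub>M borel" "g \<in> M \<rightarrow>\<^sub>M borel" for f g M
    unfolding p_def by measurable
  have sym: "w x * p x y = w y * p y x" for x y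
  proof -
    have "ennreal (exp (- U x)) * p x y = ennreal (exp (- U y)) * p y x"
      unfolding p_def by (simp flip: ennreal_mult' add: mala_acc_mult_prop[OF step_pos] min.commute)
    then have "ennreal (exp (- U x)) * p x y * inverse (\<integral>\<^sup>+ y. ennreal (exp (- U y)) \<partial>lborel)
        = ennreal (exp (- U y)) * p y x * inverse (\<integral>\<^sup>+ y. ennreal (exp (- U y)) \<partial>lborel)"
      by simp
    then show ?thesis
      unfolding w_def divide_ennreal_def by (simp only: ac_simps)
  qed
  have "(\<integral>\<^sup>+x. \<integral>\<^sup>+y. f y \<partial>N x \<partial>target U) = (\<integral>\<^sup>+x. w x * (\<integral>\<^sup>+y. f y \<partial>N x) \<partial>lborel)"
    unfolding w_def by (rule nn_integral_target) measurable
  also have "\<dots> = (\<integral>\<^sup>+x. w x * ((\<integral>\<^sup>+y. f y * p x y \<partial>lborel) + f x * rej x) \<partial>lborel)"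
    by (simp add: nn_integral_kernel p_def)
  also have "\<dots> = (\<integral>\<^sup>+x. (\<integral>\<^sup>+y. f y * (w x * p x y) \<partial>lborel) + w x * f x * rej x \<partial>lborel)"
    by (simp add: distrib_left ac_simps flip: nn_integral_cmult)
  also have "\<dots> = (\<integral>\<^sup>+x. \<integral>\<^sup>+y. f y * (w x * p x y) \<partial>lborel \<partial>lborel) + (\<integral>\<^sup>+x. w x * f x * rej x \<partial>lborel)"
    by (subst nn_integral_add) auto
  also have "(\<integral>\<^sup>+x. \<integral>\<^sup>+y. f y * (w x * p x y) \<partial>lborel \<partial>lborel)
      = (\<integral>\<^sup>+y. \<integral>\<^sup>+x. f y * (w x * p x y) \<partial>lborel \<partial>lborel)"
    by (subst lborel_pair.Fubini') auto
  also have "\<dots> = (\<integral>\<^sup>+y. w y * f y * (\<integral>\<^sup>+x. p y x \<partial>lborel) \<partial>lborel)"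
    by (simp add: sym[of _ y for y] nn_integral_cmult mult.assoc[symmetric] mult.commute[of "f _"])
  also have "\<dots> + (\<integral>\<^sup>+x. w x * f x * rej x \<partial>lborel)
      = (\<integral>\<^sup>+y. w y * f y * ((\<integral>\<^sup>+x. p y x \<partial>lborel) + rej y) \<partial>lborel)"
    by (subst nn_integral_add[symmetric]) (auto simp: distrib_left)
  also have "\<dots> = (\<integral>\<^sup>+y. w y * f y \<partial>lborel)"
    unfolding p_def accept_plus_rej by simp
  also have "\<dots> = (\<integral>\<^sup>+x. f x \<partial>target U)"
    unfolding w_def by (rule nn_integral_target[symmetric]) measurable
  finally show ?thesis .
qed

end

text \<open>Test functions bounded by V are signed and unbounded, so the identity is obtained from
  the nonnegative one on positive and negative parts. Integrability under every \<open>Q x\<close>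
  makes both parts finite, so that each inner integral is the true difference
  \<open>p x - q x\<close> and not a default value.\<close>

lemma integral_bind_pointwise:
  fixes f :: "'b \<Rightarrow> real"
  assumes Q: "Q \<in> M \<rightarrow>\<^sub>M subprob_algebra N" and f: "f \<in> borel_measurable N"
    and int: "integrable (M \<bind> Q) f" and ptw: "\<And>x. x \<in> space M \<Longrightarrow> integrable (Q x) f"
  shows "integrable M (\<lambda>x. \<integral>y. f y \<partial>Q x)"
    and "(\<integral>y. f y \<partial>(M \<bind> Q)) = (\<integral>x. \<integral>y. f y \<partial>Q x \<partial>M)"
proof -
  define p where "p = (\<lambda>x. enn2real (\<integral>\<^sup>+y. ennreal (f y) \<partial>Q x))"
  define q where "q = (\<lambda>x. enn2real (\<integral>\<^sup>+y. ennreal (- f y) \<partial>Q x))"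
  have pm: "p \<in> borel_measurable M" "q \<in> borel_measurable M"
    unfolding p_def q_def
    by (intro borel_measurable_enn2real measurable_compose[OF Q nn_integral_measurable_subprob_algebra]; use f in simp)+
  have fin: "(\<integral>\<^sup>+y. ennreal (f y) \<partial>Q x) = ennreal (p x)" "(\<integral>\<^sup>+y. ennreal (- f y) \<partial>Q x) = ennreal (q x)"
    if "x \<in> space M" for x
    using ptw[OF that] by (auto simp: p_def q_def real_integrable_def less_top)
  have B: "(\<integral>\<^sup>+y. ennreal (f y) \<partial>(M \<bind> Q)) = (\<integral>\<^sup>+x. ennreal (p x) \<partial>M)"
      "(\<integral>\<^sup>+y. ennreal (- f y) \<partial>(M \<bind> Q)) = (\<integral>\<^sup>+x. ennreal (q x) \<partial>M)"
    using f by (subst nn_integral_bind[OF _ Q]; auto intro!: nn_integral_cong simp: fin)+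
  have "(\<integral>\<^sup>+x. ennreal (p x) \<partial>M) < \<infinity>" "(\<integral>\<^sup>+x. ennreal (q x) \<partial>M) < \<infinity>"
    using int by (auto simp: real_integrable_def B less_top)
  then have pq: "integrable M p" "integrable M q"
    using pm by (auto intro!: integrableI_nonneg simp: p_def q_def)
  have S: "(\<integral>y. f y \<partial>Q x) = p x - q x" if "x \<in> space M" for x
    using ptw[OF that] by (simp add: real_lebesgue_integral_def p_def q_def)
  show "integrable M (\<lambda>x. \<integral>y. f y \<partial>Q x)"
    using pq by (subst Bochner_Integration.integrable_cong[OF refl S]) auto
  have "(\<integral>y. f y \<partial>(M \<bind> Q)) = enn2real (\<integral>\<^sup>+x. ennreal (p x) \<partial>M) - enn2real (\<integral>\<^sup>+x. ennreal (q x) \<partial>M)"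
    using int by (simp add: real_lebesgue_integral_def B)
  also have "\<dots> = (\<integral>x. p x \<partial>M) - (\<integral>x. q x \<partial>M)"
    using pm by (simp add: integral_eq_nn_integral p_def q_def)
  also have "\<dots> = (\<integral>x. p x - q x \<partial>M)"
    using pq by simp
  also have "\<dots> = (\<integral>x. \<integral>y. f y \<partial>Q x \<partial>M)"
    by (rule Bochner_Integration.integral_cong) (auto simp: S)
  finally show "(\<integral>y. f y \<partial>(M \<bind> Q)) = (\<integral>x. \<integral>y. f y \<partial>Q x \<partial>M)" .
qed

section \<open>Composition of iterates and their action on the target\<close>

context mala_chain
begin

lemma subprob_measurable_iter: "iter k \<in> borel \<rightarrow>\<^sub>M subprob_algebra borel"
  by (rule measurable_prob_algebraD[OF measurable_iter])

lemma subprob_measurable_kernel: "N \<in> borel \<rightarrow>\<^sub>M subprob_algebra borel"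
  by (rule measurable_prob_algebraD[OF measurable_kernel])

text \<open>\<open>mala_iter\<close> appends steps at the end of a path, whereas the contraction
  argument has to split off a block at its beginning.\<close>

lemma iter_add: "iter (j + k) x = iter j x \<bind> iter k"
proof (induction k)
  case 0
  have "iter 0 = return borel" by (rule ext) simp
  then show ?case by (simp add: bind_return'')
next
  case (Suc k)
  have "iter k \<in> iter j x \<rightarrow>\<^sub>M subprob_algebra borel"
    using subprob_measurable_iter by (simp cong: measurable_cong_sets)
  from bind_assoc[OF this subprob_measurable_kernel]
  have "(iter j x \<bind> iter k) \<bind> N = iter j x \<bind> (\<lambda>z. iter k z \<bind> N)" .
  moreover have "iter (Suc k) = (\<lambda>z. iter k z \<bind> N)" by (rule ext) simp
  ultimately show ?case using Suc by simp
qed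

lemma target_bind_iter:
  assumes "prob_space (target U)"
  shows "target U \<bind> iter k = target U"
proof (induction k)
  case 0
  have "iter 0 = return borel" by (rule ext) simp
  then show ?case by (simp add: bind_return'' target_def)
next
  case (Suc k)
  have st [simp, measurable_cong]: "sets (target U) = sets borel" by (simp add: target_def)
  interpret T: prob_space "target U" by fact
  have m: "iter k \<in> target U \<rightarrow>\<^sub>M subprob_algebra borel" "N \<in> target U \<rightarrow>\<^sub>M subprob_algebra borel"
    using subprob_measurable_iter subprob_measurable_kernel by (simp_all cong: measurable_cong_sets)
  have "iter (Suc k) = (\<lambda>z. iter k z \<bind> N)" by (rule ext) simp
  then have "target U \<bind> iter (Suc k) = (target U \<bind> iter k) \<bind> N"
    by (simp add: bind_assoc[OF m(1) subprob_measurable_kernel])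
  also have "\<dots> = target U \<bind> N" by (simp only: Suc)
  also have "\<dots> = target U"
  proof (rule measure_eqI)
    show "sets (target U \<bind> N) = sets (target U)"
      using T.not_empty by (subst sets_bind[where N = borel]) auto
    fix A assume "A \<in> sets (target U \<bind> N)"
    then have A [measurable]: "A \<in> sets borel"
      using T.not_empty by (subst (asm) sets_bind[where N = borel]) auto
    have "emeasure (target U \<bind> N) A = (\<integral>\<^sup>+x. emeasure (N x) A \<partial>target U)"
      by (rule emeasure_bind[OF T.not_empty m(2) A])
    also have "\<dots> = (\<integral>\<^sup>+x. \<integral>\<^sup>+y. indicator A y \<partial>N x \<partial>target U)"
      by simp
    also have "\<dots> = emeasure (target U) A"
      by (subst target_invariant) auto
    finally show "emeasure (target U \<bind> N) A = emeasure (target U) A" .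
  qed
  finally show ?case .
qed

end

section \<open>Acceptance ratio\<close>

text \<open>The expansion is at the right endpoint because the acceptance ratio contains the
  gradient at y. The auxiliary \<open>g\<close> has derivative s (f'' s - c), which is nonnegative
  on [0, 1].\<close>

lemma taylor_two_lower:
  fixes f f' f'' :: "real \<Rightarrow> real"
  assumes f: "\<And>s. (f has_real_derivative f' s) (at s)"
    and f': "\<And>s. (f' has_real_derivative f'' s) (at s)"
    and c: "\<And>s. 0 \<le> s \<Longrightarrow> s \<le> 1 \<Longrightarrow> c \<le> f'' s"
  shows "c / 2 \<le> f 0 - f 1 + f' 1"
proof -
  define g where "g = (\<lambda>s. s * f' s - f s - c * s\<^sup>2 / 2)"
  have "g 0 \<le> g 1"
  proof (rule DERIV_nonneg_imp_nondecreasing[of 0 1 g])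
    fix s :: real assume s: "0 \<le> s" "s \<le> 1"
    have "(g has_real_derivative s * (f'' s - c)) (at s)"
      unfolding g_def by (auto intro!: derivative_eq_intros f f' simp: algebra_simps)
    then show "\<exists>y. (g has_real_derivative y) (at s) \<and> 0 \<le> y"
      using c[OF s] s by (intro exI[of _ "s * (f'' s - c)"]) auto
  qed simp
  then show ?thesis by (simp add: g_def)
qed

locale smooth_potential =
  fixes U :: "'a::euclidean_space \<Rightarrow> real"
    and gradU :: "'a \<Rightarrow> 'a"
    and H :: "'a \<Rightarrow> ('a \<Rightarrow>\<^sub>L 'a)"
    and L m K :: real
  assumes grad: "\<And>x. (U has_derivative (\<lambda>h. gradU x \<bullet> h)) (at x)"
    and hess: "\<And>x. (gradU has_derivative blinfun_apply (H x)) (at x)"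
    and grad0: "gradU 0 = 0"
    and L: "L \<ge> 0" "\<And>x. norm (H x) \<le> L"
    and m: "m > 0" and K: "K \<ge> 0"
    and convex: "\<And>x y. norm x \<ge> K \<Longrightarrow> norm y = 1 \<Longrightarrow> (H x y) \<bullet> y \<ge> m"
begin

section \<open>Growth of the potential and its gradient\<close>

lemma gradU_lipschitz: "norm (gradU x - gradU y) \<le> L * norm (x - y)"
  using L(2) by (intro differentiable_bound[of UNIV _ "\<lambda>x. blinfun_apply (H x)"])
    (auto simp: norm_blinfun.rep_eq[symmetric] hess)

lemma norm_gradU: "norm (gradU x) \<le> L * norm x"
  using gradU_lipschitz[of x 0] by (simp add: grad0)

lemma hess_abs: "\<bar>H x h \<bullet> h\<bar> \<le> L * (norm h)\<^sup>2"
proof -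
  have "\<bar>H x h \<bullet> h\<bar> \<le> norm (H x h) * norm h" by (rule Cauchy_Schwarz_ineq2)
  also have "\<dots> \<le> (norm (H x) * norm h) * norm h" by (intro mult_right_mono norm_blinfun) auto
  also have "\<dots> \<le> (L * norm h) * norm h" by (intro mult_right_mono L) auto
  finally show ?thesis by (simp add: power2_eq_square mult.assoc)
qed

lemma hess_lower: "norm x \<ge> K \<Longrightarrow> m * (norm h)\<^sup>2 \<le> H x h \<bullet> h"
proof (cases "h = 0")
  case False
  assume x: "norm x \<ge> K"
  have "m \<le> H x (h /\<^sub>R norm h) \<bullet> (h /\<^sub>R norm h)"
    using False by (intro convex x) simp
  also have "\<dots> = (H x h \<bullet> h) / (norm h)\<^sup>2"
    by (simp add: blinfun.scaleR_right power2_eq_square field_simps)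
  finally show ?thesis using False by (simp add: field_simps)
qed simp

lemma line_deriv:
  "((\<lambda>s. U (x + s *\<^sub>R h)) has_real_derivative gradU (x + s *\<^sub>R h) \<bullet> h) (at s)"
  "((\<lambda>s. gradU (x + s *\<^sub>R h) \<bullet> h) has_real_derivative H (x + s *\<^sub>R h) h \<bullet> h) (at s)"
proof -
  have l: "((\<lambda>s. x + s *\<^sub>R h) has_derivative (\<lambda>t. t *\<^sub>R h)) (at s)"
    by (auto intro!: derivative_eq_intros)
  have "((\<lambda>s. U (x + s *\<^sub>R h)) has_derivative (\<lambda>t. gradU (x + s *\<^sub>R h) \<bullet> (t *\<^sub>R h))) (at s)"
    using has_derivative_compose[OF l grad] by simp
  then show "((\<lambda>s. U (x + s *\<^sub>R h)) has_real_derivative gradU (x + s *\<^sub>R h) \<bullet> h) (at s)"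
    unfolding has_field_derivative_def by (rule has_derivative_eq_rhs) (auto simp: mult.commute)
  have "((\<lambda>s. gradU (x + s *\<^sub>R h) \<bullet> h) has_derivative (\<lambda>t. H (x + s *\<^sub>R h) (t *\<^sub>R h) \<bullet> h)) (at s)"
    using has_derivative_inner_left[OF has_derivative_compose[OF l hess]] by simp
  then show "((\<lambda>s. gradU (x + s *\<^sub>R h) \<bullet> h) has_real_derivative H (x + s *\<^sub>R h) h \<bullet> h) (at s)"
    unfolding has_field_derivative_def
    by (rule has_derivative_eq_rhs) (auto simp: mult.commute blinfun.scaleR_right)
qed

lemma taylor_lower:
  assumes "\<And>s. 0 \<le> s \<Longrightarrow> s \<le> 1 \<Longrightarrow> c \<le> H (x + s *\<^sub>R (y - x)) (y - x) \<bullet> (y - x)"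
  shows "c / 2 \<le> U x - U y + gradU y \<bullet> (y - x)"
  using taylor_two_lower[OF line_deriv(1) line_deriv(2), of c x "y - x"] assms by simp

lemma taylor_abs: "\<bar>U x - U y + gradU y \<bullet> (y - x)\<bar> \<le> L / 2 * (norm (y - x))\<^sup>2"
proof -
  have "- L * (norm (y - x))\<^sup>2 / 2 \<le> U x - U y + gradU y \<bullet> (y - x)"
    using hess_abs[of _ "y - x"] by (intro taylor_lower) (auto simp: abs_le_iff minus_le_iff)
  moreover have "- L * (norm (y - x))\<^sup>2 / 2 \<le> - U x - - U y + - (gradU y \<bullet> (y - x))"
    using taylor_two_lower[OF DERIV_minus[OF line_deriv(1)] DERIV_minus[OF line_deriv(2)],
        of "- L * (norm (y - x))\<^sup>2" x "y - x"] hess_abs[of _ "y - x"]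
    by (auto simp: abs_le_iff)
  ultimately show ?thesis by linarith
qed

text \<open>Along the ray through x the radial derivative has slope at least m |x|^2 once the ray
  has left the ball of radius K, at parameter t0 = K / |x|; up to there only the Lipschitz bound is
  available. The linear term is the deficit at t0: L K |x| from the Lipschitz bound and m K |x| from
  the missing growth.\<close>

lemma gradU_radial:
  assumes t: "t \<ge> 0"
  shows "m * t * (norm x)\<^sup>2 - (m + L) * K * norm x \<le> gradU (t *\<^sub>R x) \<bullet> x"
proof -
  have crude: "- (L * s * (norm x)\<^sup>2) \<le> gradU (s *\<^sub>R x) \<bullet> x" if "s \<ge> 0" for s
  proof -
    have "\<bar>gradU (s *\<^sub>R x) \<bullet> x\<bar> \<le> norm (gradU (s *\<^sub>R x)) * norm x" by (rule Cauchy_Schwarz_ineq2)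
    also have "\<dots> \<le> (L * norm (s *\<^sub>R x)) * norm x" by (intro mult_right_mono norm_gradU) auto
    finally show ?thesis using that by (simp add: power2_eq_square mult.assoc)
  qed
  show ?thesis
  proof (cases "t * norm x \<le> K")
    case True
    then have "(m + L) * (t * norm x) * norm x \<le> (m + L) * K * norm x"
      using m L by (intro mult_right_mono mult_left_mono) auto
    then show ?thesis using crude[OF t] by (simp add: power2_eq_square algebra_simps)
  next
    case False
    then have x: "norm x > 0" using K t by (cases "x = 0") auto
    define t0 where "t0 = K / norm x"
    have t0: "0 \<le> t0" "t0 \<le> t" using x K False by (auto simp: t0_def field_simps)
    define g where "g = (\<lambda>s. gradU (0 + s *\<^sub>R x) \<bullet> x - m * (norm x)\<^sup>2 * s)"
    have "g t0 \<le> g t"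
    proof (rule DERIV_nonneg_imp_nondecreasing[OF t0(2)])
      fix s assume s: "t0 \<le> s" "s \<le> t"
      have "(g has_real_derivative H (0 + s *\<^sub>R x) x \<bullet> x - m * (norm x)\<^sup>2) (at s)"
        unfolding g_def by (rule derivative_eq_intros line_deriv refl | simp)+
      moreover have "K \<le> norm (0 + s *\<^sub>R x)"
        using s t0 x by (simp add: abs_of_nonneg[OF order_trans[OF t0(1) s(1)]]) (simp add: t0_def pos_divide_le_eq)
      then have "0 \<le> H (0 + s *\<^sub>R x) x \<bullet> x - m * (norm x)\<^sup>2"
        using hess_lower by simp
      ultimately show "\<exists>y. (g has_real_derivative y) (at s) \<and> 0 \<le> y"
        by blast
    qed
    moreover have "t0 * (norm x)\<^sup>2 = K * norm x" using x by (simp add: t0_def power2_eq_square)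
    ultimately show ?thesis
      using crude[OF t0(1)] by (simp add: g_def algebra_simps)
  qed
qed

lemma U_lower: "U 0 + m / 2 * (norm x)\<^sup>2 - (m + L) * K * norm x \<le> U x"
proof -
  define g where "g = (\<lambda>s. U (0 + s *\<^sub>R x) - (m * (norm x)\<^sup>2 * (s\<^sup>2 / 2) - (m + L) * K * norm x * s))"
  have "g 0 \<le> g 1"
  proof (rule DERIV_nonneg_imp_nondecreasing[of 0 1 g])
    fix s :: real assume s: "0 \<le> s" "s \<le> 1"
    have "(g has_real_derivative gradU (0 + s *\<^sub>R x) \<bullet> x - (m * (norm x)\<^sup>2 * s - (m + L) * K * norm x)) (at s)"
      unfolding g_def by (rule derivative_eq_intros line_deriv refl | simp)+
    then show "\<exists>y. (g has_real_derivative y) (at s) \<and> 0 \<le> y"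
      using gradU_radial[OF s(1), of x] by (auto simp: algebra_simps intro!: exI)
  qed simp
  then show ?thesis by (simp add: g_def)
qed

lemma continuous_U: "continuous_on UNIV U" and continuous_gradU: "continuous_on UNIV gradU"
  by (meson grad hess has_derivative_continuous_on has_derivative_at_withinI)+

lemma mala_chain: "\<gamma> > 0 \<Longrightarrow> mala_chain U gradU \<gamma>"
  by unfold_locales (auto intro: borel_measurable_continuous_onI continuous_U continuous_gradU)


text \<open>The point is that nothing of order 1/\<gamma> survives. The displacement of the reverse
  move from its mean is \<xi> - 2 h + \<gamma> D, so the terms |\<xi>|^2 cancel, and \<xi> \<bullet>
  h - |h|^2 equals \<gamma> times the directional derivative of U at x along h.\<close>

lemma mala_ratio:
  fixes x y :: 'a and \<gamma> :: real
  defines "D \<equiv> gradU y - gradU x" and "\<xi> \<equiv> y - x + \<gamma> *\<^sub>R gradU x"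
  assumes \<gamma>: "\<gamma> > 0"
  shows "(exp (- U y) * mala_prop gradU \<gamma> y x) / (exp (- U x) * mala_prop gradU \<gamma> x y)
    = exp (U x - U y + gradU y \<bullet> (y - x) - D \<bullet> \<xi> / 2 - \<gamma> / 4 * (norm D)\<^sup>2)"
proof -
  define h where "h = y - x"
  have e: "x - y + \<gamma> *\<^sub>R gradU y = \<xi> - 2 *\<^sub>R h + \<gamma> *\<^sub>R D"
    by (simp add: \<xi>_def h_def D_def algebra_simps scaleR_2)
  have gx: "\<gamma> * (gradU x \<bullet> h) = \<xi> \<bullet> h - h \<bullet> h"
    by (simp add: \<xi>_def h_def inner_add_left)
  have gy: "gradU y \<bullet> h = gradU x \<bullet> h + D \<bullet> h" by (simp add: D_def inner_diff_left)
  have "(norm \<xi>)\<^sup>2 - (norm (\<xi> - 2 *\<^sub>R h + \<gamma> *\<^sub>R D))\<^sup>2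
      = 4 * (\<xi> \<bullet> h - h \<bullet> h) + 4 * \<gamma> * (D \<bullet> h) - 2 * \<gamma> * (D \<bullet> \<xi>) - \<gamma>\<^sup>2 * (norm D)\<^sup>2"
    unfolding power2_norm_eq_inner
    by (simp add: inner_add_left inner_add_right inner_diff_left inner_diff_right
        inner_commute power2_eq_square algebra_simps)
  also have "\<dots> = 4 * \<gamma> * (gradU y \<bullet> h - D \<bullet> \<xi> / 2 - \<gamma> / 4 * (norm D)\<^sup>2)"
    unfolding gx[symmetric] gy by (simp add: algebra_simps power2_eq_square)
  finally have k: "((norm \<xi>)\<^sup>2 - (norm (x - y + \<gamma> *\<^sub>R gradU y))\<^sup>2) / (4 * \<gamma>)
      = gradU y \<bullet> h - D \<bullet> \<xi> / 2 - \<gamma> / 4 * (norm D)\<^sup>2"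
    using \<gamma> by (simp add: e)
  have "(exp (- U y) * mala_prop gradU \<gamma> y x) / (exp (- U x) * mala_prop gradU \<gamma> x y)
      = exp (U x - U y + ((norm \<xi>)\<^sup>2 - (norm (x - y + \<gamma> *\<^sub>R gradU y))\<^sup>2) / (4 * \<gamma>))"
  proof -
    have q: "exp a * (k * exp b) / (exp c * (k * exp d)) = exp (a + b - (c + d))"
      if "k > 0" for a b c d k :: real
      using that by (simp add: exp_diff exp_add)
    have "0 < (4 * pi * \<gamma>) powr (- real DIM('a) / 2)" using \<gamma> by simp
    from q[OF this] show ?thesis
      unfolding mala_prop_def \<xi>_def[symmetric] by (simp add: diff_divide_distrib)
  qed
  then show ?thesis unfolding k h_def by (simp add: algebra_simps)
qed

text \<open>The term L^2 / (4 m) comes from completing the square of D \<bullet> \<xi> / 2 against m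
  |h|^2 / 4 in the convex region, and 4 L covers the moves with |h| \<le> 2 |\<xi>|. The constant
  \<open>cstep\<close> is the contribution of the gradient step when |x| < 2 K.\<close>

definition "cnoise = L\<^sup>2 / (4 * m) + 4 * L"
definition "cstep = 2 * L\<^sup>2 * K\<^sup>2"

lemma cnoise_nonneg: "0 \<le> cnoise" and cstep_nonneg: "0 \<le> cstep"
  using m L by (auto simp: cnoise_def cstep_def)

lemma mala_acc_lower:
  fixes x y :: 'a and \<gamma> :: real
  defines "\<xi> \<equiv> y - x + \<gamma> *\<^sub>R gradU x"
  assumes \<gamma>: "\<gamma> > 0" "\<gamma> * L \<le> 1 / 4" "\<gamma> * L\<^sup>2 \<le> m"
  shows "exp (- (cstep * \<gamma> + cnoise * (norm \<xi>)\<^sup>2)) \<le> mala_acc U gradU \<gamma> x y"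
proof -
  define D where "D = gradU y - gradU x"
  define h where "h = y - x"
  have D: "norm D \<le> L * norm h" unfolding D_def h_def by (rule gradU_lipschitz)
  have D1: "D \<bullet> \<xi> / 2 \<le> L / 2 * (norm h * norm \<xi>)"
  proof -
    have "D \<bullet> \<xi> \<le> norm D * norm \<xi>" by (rule norm_cauchy_schwarz)
    also have "\<dots> \<le> (L * norm h) * norm \<xi>" by (intro mult_right_mono D) auto
    finally show ?thesis by simp
  qed
  have D2: "\<gamma> / 4 * (norm D)\<^sup>2 \<le> \<gamma> * L\<^sup>2 / 4 * (norm h)\<^sup>2"
  proof -
    have "(norm D)\<^sup>2 \<le> (L * norm h)\<^sup>2" using D by (intro power_mono) auto
    then show ?thesis using \<gamma> by (simp add: power_mult_distrib mult.assoc)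
  qed
  define T where "T = U x - U y + gradU y \<bullet> (y - x)"
  have h\<xi>: "norm h \<le> norm \<xi> + \<gamma> * L * norm x"
  proof -
    have "norm h = norm (\<xi> - \<gamma> *\<^sub>R gradU x)" by (simp add: h_def \<xi>_def)
    also have "\<dots> \<le> norm \<xi> + \<gamma> * norm (gradU x)"
      using norm_triangle_ineq4[of \<xi> "\<gamma> *\<^sub>R gradU x"] \<gamma> by simp
    also have "\<dots> \<le> norm \<xi> + \<gamma> * (L * norm x)"
      using \<gamma> norm_gradU[of x] by (intro add_left_mono mult_left_mono) auto
    finally show ?thesis by (simp add: mult.assoc)
  qed
  have Tab: "- (L / 2 * (norm h)\<^sup>2) \<le> T"
    using taylor_abs[of x y] unfolding T_def h_def by linarith
  have gL: "\<gamma> * L\<^sup>2 / 4 * (norm h)\<^sup>2 \<le> L / 16 * (norm h)\<^sup>2"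
  proof (rule mult_right_mono)
    show "\<gamma> * L\<^sup>2 / 4 \<le> L / 16"
      using mult_right_mono[OF \<gamma>(2) L(1)] by (simp add: power2_eq_square ac_simps)
  qed simp
  have mix: "norm h * norm \<xi> \<le> ((norm h)\<^sup>2 + (norm \<xi>)\<^sup>2) / 2"
    using sum_squares_bound[of "norm h" "norm \<xi>"] by simp
  have "- (cstep * \<gamma> + cnoise * (norm \<xi>)\<^sup>2) \<le> T - D \<bullet> \<xi> / 2 - \<gamma> / 4 * (norm D)\<^sup>2"
  proof -
    \<comment> \<open>Near the centre the gradient step contributes at most 2 \<gamma> L K to |h|.
      If the noise exceeds |x| / 4, it dominates the gradient step, which is at most |x| / 4.
      Otherwise |h| \<le> |x| / 2, so the whole segment stays at distance at least |x| / 2 \<ge> K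
      from the origin and strong convexity applies along it.\<close>
    consider (a) "norm x < 2 * K" | (b) "norm x \<ge> 2 * K" "norm \<xi> > norm x / 4"
      | (c) "norm x \<ge> 2 * K" "norm \<xi> \<le> norm x / 4" by linarith
    then show ?thesis
    proof cases
      case a
      have "norm h \<le> norm \<xi> + 2 * (\<gamma> * L * K)"
      proof -
        have "\<gamma> * L * norm x \<le> \<gamma> * L * (2 * K)" using a \<gamma> L by (intro mult_left_mono) auto
        then show ?thesis using h\<xi> by simp
      qed
      then have "(norm h)\<^sup>2 \<le> (norm \<xi> + 2 * (\<gamma> * L * K))\<^sup>2" by (intro power_mono) auto
      also have "\<dots> \<le> 2 * (norm \<xi>)\<^sup>2 + 8 * (\<gamma> * L * K)\<^sup>2"
        using sum_squares_bound[of "norm \<xi>" "2 * (\<gamma> * L * K)"]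
        by (simp add: power2_sum power_mult_distrib ac_simps)
      also have "8 * (\<gamma> * L * K)\<^sup>2 \<le> 2 * \<gamma> * L * K\<^sup>2"
      proof -
        have "(8 * \<gamma> * L * K\<^sup>2) * (\<gamma> * L) \<le> (8 * \<gamma> * L * K\<^sup>2) * (1/4)"
          using \<gamma> L K by (intro mult_left_mono) auto
        then show ?thesis by (simp add: power2_eq_square algebra_simps)
      qed
      finally have h2: "L * (norm h)\<^sup>2 \<le> L * (2 * (norm \<xi>)\<^sup>2 + 2 * \<gamma> * L * K\<^sup>2)"
        using L by (intro mult_left_mono) auto
      have mixL: "L * (norm h * norm \<xi>) \<le> L * (((norm h)\<^sup>2 + (norm \<xi>)\<^sup>2) / 2)"
        using L mix by (intro mult_left_mono) auto
      have pos: "0 \<le> L * (norm h)\<^sup>2" "0 \<le> L * (norm \<xi>)\<^sup>2" "0 \<le> L\<^sup>2 / (4 * m) * (norm \<xi>)\<^sup>2" using L m by auto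
      show ?thesis
        using D1 D2 Tab gL h2 mixL pos unfolding cstep_def cnoise_def
        by (simp add: algebra_simps power2_eq_square)
    next
      case b
      have "\<gamma> * L * norm x \<le> 1/4 * norm x" using \<gamma> by (intro mult_right_mono) auto
      then have hh: "norm h \<le> 2 * norm \<xi>" using h\<xi> b by simp
      then have "(norm h)\<^sup>2 \<le> (2 * norm \<xi>)\<^sup>2" by (intro power_mono) auto
      then have 1: "L * (norm h)\<^sup>2 \<le> L * (4 * (norm \<xi>)\<^sup>2)" using L by (intro mult_left_mono) auto
      have 2: "L * (norm h * norm \<xi>) \<le> L * (2 * norm \<xi> * norm \<xi>)"
        using L hh by (intro mult_left_mono mult_right_mono) auto
      have pos: "0 \<le> L * (norm \<xi>)\<^sup>2" "0 \<le> L\<^sup>2 / (4 * m) * (norm \<xi>)\<^sup>2" "0 \<le> L\<^sup>2 * K\<^sup>2 * \<gamma>" using L m \<gamma> by auto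
      show ?thesis
        using D1 D2 Tab gL 1 2 pos unfolding cstep_def cnoise_def
        by (simp add: algebra_simps power2_eq_square)
    next
      case c
      have "\<gamma> * L * norm x \<le> 1/4 * norm x" using \<gamma> by (intro mult_right_mono) auto
      then have hh: "norm h \<le> norm x / 2" using h\<xi> c by simp
      have "m * (norm h)\<^sup>2 / 2 \<le> T"
        unfolding T_def h_def
      proof (intro taylor_lower hess_lower)
        fix s :: real assume s: "0 \<le> s" "s \<le> 1"
        have "norm (s *\<^sub>R (y - x)) \<le> norm h"
          using s by (simp add: h_def mult_left_le_one_le)
        then show "K \<le> norm (x + s *\<^sub>R (y - x))"
          using c hh norm_diff_ineq[of x "s *\<^sub>R (y - x)"] by linarith
      qed
      moreover have "\<gamma> * L\<^sup>2 / 4 * (norm h)\<^sup>2 \<le> m / 4 * (norm h)\<^sup>2"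
        using \<gamma> by (intro mult_right_mono) auto
      moreover have "L / 2 * (norm h * norm \<xi>) \<le> m / 4 * (norm h)\<^sup>2 + L\<^sup>2 / (4 * m) * (norm \<xi>)\<^sup>2"
      proof -
        have "0 \<le> (m * norm h - L * norm \<xi>)\<^sup>2 / (4 * m)" using m by simp
        also have "\<dots> = m / 4 * (norm h)\<^sup>2 + L\<^sup>2 / (4 * m) * (norm \<xi>)\<^sup>2 - L / 2 * (norm h * norm \<xi>)"
          using m by (simp add: power2_diff power_mult_distrib field_simps) (simp add: power2_eq_square)
        finally show ?thesis by simp
      qed
      moreover have "0 \<le> L * (norm \<xi>)\<^sup>2" "0 \<le> L\<^sup>2 * K\<^sup>2 * \<gamma>" using L \<gamma> by auto
      ultimately show ?thesis
        using D1 D2 unfolding cstep_def cnoise_def by (simp add: algebra_simps)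
    qed
  qed
  moreover have "0 \<le> cstep * \<gamma> + cnoise * (norm \<xi>)\<^sup>2"
    using cstep_nonneg cnoise_nonneg \<gamma> by simp
  ultimately show ?thesis
    unfolding mala_acc_def mala_ratio[OF \<gamma>(1)] D_def[symmetric] \<xi>_def[symmetric] T_def
    by simp
qed

end

section \<open>Drift condition\<close>

text \<open>Turns ratios of Gaussian normalising constants into exponential losses, which multiply
  conveniently over many steps.\<close>

lemma one_minus_le_powr_neg:
  assumes "0 \<le> (u::real)" "0 \<le> p"
  shows "exp (- (u * p)) \<le> (1 + u) powr (- p)"
proof -
  have "ln (1 + u) \<le> u" using assms(1) by (rule ln_add_one_self_le_self)
  then have "ln (1 + u) * p \<le> u * p" using assms(2) by (rule mult_right_mono)
  then have "exp (- (u * p)) \<le> exp (- p * ln (1 + u))" by (simp add: mult.commute)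
  also have "\<dots> = (1 + u) powr (- p)" using assms by (simp add: powr_def)
  finally show ?thesis .
qed

context smooth_potential
begin

text \<open>Under the proposal \<xi> is centred Gaussian with covariance 2 \<gamma> times the
  identity, so |\<xi>|^2 has mean 2 \<gamma> \<open>DIM('a)\<close>; thus
  \<open>crej * \<gamma>\<close> is the mean of the exponent in
  \<open>mala_acc_lower\<close>.\<close>

definition "crej = cstep + 2 * cnoise * DIM('a)"

lemma crej_nonneg: "0 \<le> crej"
  using cstep_nonneg cnoise_nonneg by (simp add: crej_def)

text \<open>The lower bound on the acceptance probability is a Gaussian in \<xi>, so its mean under
  the proposal is explicit: \<open>exp (- (cstep * \<gamma>))\<close> times the power -d/2 of 1 + 4
  \<gamma> cnoise, where d is the dimension.\<close>

lemma rej_le: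
  assumes \<gamma>: "\<gamma> > 0" "\<gamma> * L \<le> 1 / 4" "\<gamma> * L\<^sup>2 \<le> m"
  shows "mala_chain.rej U gradU \<gamma> x \<le> ennreal (crej * \<gamma>)"
proof -
  interpret mala_chain U gradU \<gamma> by (rule mala_chain[OF \<gamma>(1)])
  define d where "d = real DIM('a) / 2"
  define P where "P = (4 * pi * \<gamma>) powr (- d)"
  have P: "P > 0" using \<gamma> by (simp add: P_def)
  let ?\<xi> = "\<lambda>y. y - x + \<gamma> *\<^sub>R gradU x"
  define a where "a = 1 / (4 * \<gamma>) + cnoise"
  have a: "a > 0" using \<gamma> cnoise_nonneg by (simp add: a_def add_pos_nonneg)
  have lower: "exp (- (cstep * \<gamma>)) * P * exp (- a * (norm (y - (x - \<gamma> *\<^sub>R gradU x)))\<^sup>2) \<le> \<alpha> x y * r x y" for y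
  proof -
    have "exp (- (cstep * \<gamma>)) * P * exp (- a * (norm (?\<xi> y))\<^sup>2)
       = exp (- (cstep * \<gamma> + cnoise * (norm (?\<xi> y))\<^sup>2)) * r x y"
    proof -
      have "exp (- a * n) = exp (- (cnoise * n)) * exp (- n / (4 * \<gamma>))" for n
        by (simp add: a_def algebra_simps flip: exp_add)
      moreover have "exp (- (s + t)) = exp (- s) * exp (- t)" for s t :: real
        by (simp flip: exp_add)
      ultimately show ?thesis
        by (simp add: mala_prop_def P_def d_def)
    qed
    also have "\<dots> \<le> \<alpha> x y * r x y"
      using mala_acc_lower[OF \<gamma>, where x = x and y = y] r_pos[of x y] by (intro mult_right_mono) auto
    finally show ?thesis by (simp add: algebra_simps)
  qed
  have "1 - crej * \<gamma> \<le> exp (- (cstep * \<gamma>)) * exp (- (4 * \<gamma> * cnoise * d))"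
    using exp_ge_add_one_self[of "- (crej * \<gamma>)"]
    by (simp add: crej_def d_def algebra_simps flip: exp_add)
  also have "\<dots> \<le> exp (- (cstep * \<gamma>)) * (1 + 4 * \<gamma> * cnoise) powr (- d)"
    using \<gamma> cnoise_nonneg by (intro mult_left_mono one_minus_le_powr_neg) (auto simp: d_def)
  also have "(1 + 4 * \<gamma> * cnoise) powr (- d) = P * (pi / a) powr d"
  proof -
    have "pi / a = (4 * pi * \<gamma>) / (1 + 4 * \<gamma> * cnoise)"
      using \<gamma> cnoise_nonneg by (simp add: a_def field_simps)
    then have "(pi / a) powr d = (4 * pi * \<gamma>) powr d / (1 + 4 * \<gamma> * cnoise) powr d"
      using \<gamma> cnoise_nonneg by (simp only: powr_divide)
    then show ?thesis
      using \<gamma> by (simp add: P_def powr_minus inverse_eq_divide)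
  qed
  finally have 1: "1 - crej * \<gamma> \<le> exp (- (cstep * \<gamma>)) * P * (pi / a) powr d"
    by (simp add: mult.assoc)
  have "ennreal (1 - crej * \<gamma>) \<le> ennreal (exp (- (cstep * \<gamma>)) * P) * ennreal ((pi / a) powr d)"
    using 1 P by (subst ennreal_mult[symmetric]) (auto intro: ennreal_leI)
  also have "ennreal ((pi / a) powr d) = (\<integral>\<^sup>+y. ennreal (exp (- a * (norm (y - (x - \<gamma> *\<^sub>R gradU x)))\<^sup>2)) \<partial>lborel)"
    unfolding d_def by (rule nn_integral_gaussian[OF a, symmetric])
  also have "ennreal (exp (- (cstep * \<gamma>)) * P) * \<dots>
     = (\<integral>\<^sup>+y. ennreal (exp (- (cstep * \<gamma>)) * P * exp (- a * (norm (y - (x - \<gamma> *\<^sub>R gradU x)))\<^sup>2)) \<partial>lborel)"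
    using P by (subst nn_integral_cmult[symmetric]) (auto simp: ennreal_mult)
  also have "\<dots> \<le> (\<integral>\<^sup>+y. ennreal (\<alpha> x y * r x y) \<partial>lborel)"
    by (intro nn_integral_mono ennreal_leI lower)
  finally have "ennreal (1 - crej * \<gamma>) + rej x \<le> 1"
    using accept_plus_rej[of x] by (metis add_right_mono)
  \<comment> \<open>\<open>ennreal\<close> truncates a negative \<open>1 - crej * \<gamma>\<close>
    to 0, so the two summands may exceed 1 and only this inequality is available; it suffices to
    cancel the finite first summand.\<close>
  moreover have "1 \<le> ennreal (1 - crej * \<gamma>) + ennreal (crej * \<gamma>)"
  proof -
    define t where "t = crej * \<gamma>"
    have t: "0 \<le> t" using crej_nonneg \<gamma> by (simp add: t_def)
    have "1 = ennreal (1 - t + t)" by simp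
    also have "\<dots> \<le> ennreal (1 - t) + ennreal t"
    proof (cases "t \<le> 1")
      case True
      then show ?thesis using t by (subst ennreal_plus) auto
    next
      case False
      then have "ennreal (1 - t) = 0" "ennreal (1 - t + t) \<le> ennreal t"
        by (simp_all only: ennreal_neg, intro ennreal_leI, simp)
      then show ?thesis by simp
    qed
    finally show ?thesis by (simp add: t_def)
  qed
  ultimately have "ennreal (1 - crej * \<gamma>) + rej x \<le> ennreal (1 - crej * \<gamma>) + ennreal (crej * \<gamma>)"
    by (rule order_trans)
  then show ?thesis by (simp add: ennreal_add_left_cancel_le)
qed

section \<open>The exponential weight and its one-step drift\<close>

definition "\<eta> = m / 16"
definition "V = (\<lambda>x::'a. exp (\<eta> * (norm x)\<^sup>2))"

lemma V_ge_1: "1 \<le> V x" and V_pos: "0 < V x"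
  using m by (auto simp: V_def \<eta>_def)

lemma V_measurable [measurable]: "V \<in> borel_measurable borel"
  unfolding V_def by measurable

lemma \<eta>_pos: "\<eta> > 0" using m by (simp add: \<eta>_def)

text \<open>An exact Gaussian integral. Averaging V over noise of variance 2 \<gamma> per coordinate
  replaces \<eta> by \<eta> / (1 - u) with u = 4 \<eta> \<gamma> and contributes 1 / (1 - u) to the
  power half the dimension; u \<le> 1/2 gives 1 / (1 - u) \<le> 1 + 2 u.\<close>

lemma nn_integral_V_prop:
  assumes \<gamma>: "\<gamma> > 0" "4 * \<eta> * \<gamma> \<le> 1 / 2"
  shows "(\<integral>\<^sup>+y. ennreal (V y) * ennreal (mala_prop gradU \<gamma> x y) \<partial>lborel)
    \<le> ennreal (exp (4 * \<eta> * DIM('a) * \<gamma> + \<eta> * (1 + 8 * \<eta> * \<gamma>) * (norm (x - \<gamma> *\<^sub>R gradU x))\<^sup>2))"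
proof -
  define c where "c = x - \<gamma> *\<^sub>R gradU x"
  define d where "d = real DIM('a) / 2"
  define A where "A = 1 / (4 * \<gamma>)"
  define P where "P = (4 * pi * \<gamma>) powr (- d)"
  define u where "u = 4 * \<eta> * \<gamma>"
  have u: "0 \<le> u" "u \<le> 1 / 2" using \<gamma> \<eta>_pos by (auto simp: u_def)
  have A\<eta>: "A + - \<eta> = (1 - u) / (4 * \<gamma>)" using \<gamma> by (simp add: A_def u_def field_simps)
  have pos: "A + - \<eta> > 0" unfolding A\<eta> using u \<gamma> by (intro divide_pos_pos) auto
  have P: "0 \<le> P" by (simp add: P_def)
  have eq: "V y * mala_prop gradU \<gamma> x y = P * exp (- (A * (norm (y - c))\<^sup>2 + - \<eta> * (norm y)\<^sup>2))" for y
  proof -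
    have "V y * mala_prop gradU \<gamma> x y = P * (exp (\<eta> * (norm y)\<^sup>2) * exp (- (norm (y - c))\<^sup>2 / (4 * \<gamma>)))"
      by (simp add: V_def mala_prop_def P_def d_def c_def algebra_simps)
    then show ?thesis by (simp flip: exp_add add: A_def)
  qed
  have inv: "1 / (1 - u) \<le> 1 + 2 * u"
  proof -
    have "0 \<le> u * (1 - 2 * u)" using u by simp
    then show ?thesis using u by (simp add: field_simps)
  qed
  have "(\<integral>\<^sup>+y. ennreal (V y) * ennreal (mala_prop gradU \<gamma> x y) \<partial>lborel)
    = (\<integral>\<^sup>+y. ennreal P * ennreal (exp (- (A * (norm (y - c))\<^sup>2 + - \<eta> * (norm y)\<^sup>2))) \<partial>lborel)"
    using P V_pos by (subst ennreal_mult'[symmetric], simp add: less_imp_le, subst ennreal_mult[symmetric]) (auto simp only: eq exp_ge_zero)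
  also have "\<dots> = ennreal P * ennreal (exp (- (A * - \<eta> / (A + - \<eta>) * (norm c)\<^sup>2)) * (pi / (A + - \<eta>)) powr d)"
    unfolding d_def by (subst nn_integral_cmult) (auto simp only: nn_integral_gaussian_product[OF pos], simp)
  also have "\<dots> = ennreal (exp (- (A * - \<eta> / (A + - \<eta>) * (norm c)\<^sup>2)) * (P * (pi / (A + - \<eta>)) powr d))"
    using P by (subst ennreal_mult[symmetric]) (auto simp: ac_simps)
  also have "\<dots> \<le> ennreal (exp (\<eta> * (1 + 8 * \<eta> * \<gamma>) * (norm c)\<^sup>2) * exp (4 * \<eta> * DIM('a) * \<gamma>))"
  proof (intro ennreal_leI mult_mono)
    have "- (A * - \<eta> / (A + - \<eta>)) = \<eta> * (1 / (1 - u))"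
      unfolding A\<eta> using u \<gamma> by (simp add: A_def field_simps)
    also have "\<dots> \<le> \<eta> * (1 + 2 * u)" using inv \<eta>_pos by (intro mult_left_mono) auto
    finally have "- (A * - \<eta> / (A + - \<eta>)) * (norm c)\<^sup>2 \<le> \<eta> * (1 + 2 * u) * (norm c)\<^sup>2"
      by (intro mult_right_mono) auto
    then show "exp (- (A * - \<eta> / (A + - \<eta>) * (norm c)\<^sup>2)) \<le> exp (\<eta> * (1 + 8 * \<eta> * \<gamma>) * (norm c)\<^sup>2)"
      by (simp add: u_def mult.assoc)
    have "P * (pi / (A + - \<eta>)) powr d = (1 / (1 - u)) powr d"
    proof -
      have "pi / (A + - \<eta>) = (4 * pi * \<gamma>) * (1 / (1 - u))"
        unfolding A\<eta> using \<gamma> u by (simp add: field_simps)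
      then have "(pi / (A + - \<eta>)) powr d = (4 * pi * \<gamma>) powr d * (1 / (1 - u)) powr d"
        using \<gamma> u by (simp only: powr_mult)
      then show ?thesis using \<gamma> by (simp add: P_def powr_minus)
    qed
    also have "\<dots> \<le> (exp (2 * u)) powr d"
      using order_trans[OF inv exp_ge_add_one_self] u by (intro powr_mono2) (auto simp: d_def)
    also have "\<dots> = exp (4 * \<eta> * DIM('a) * \<gamma>)"
      by (simp add: powr_def u_def d_def)
    finally show "P * (pi / (A + - \<eta>)) powr d \<le> exp (4 * \<eta> * DIM('a) * \<gamma>)" .
  qed (use P in auto)
  finally show ?thesis by (simp add: c_def mult_exp_exp add.commute)
qed

text \<open>A squared radius. The first entry makes (m + L) K at most m |x| / 2, so that
  \<open>gradU_radial\<close> retains half its rate; the second makes the gain \<eta> m |x|^2 / 4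
  per unit time cover the dimension term and 2 crej + 2.\<close>

definition "rdrift2 = max ((2 * (m + L) * K / m)\<^sup>2) (4 * (4 * \<eta> * DIM('a) + 2 * crej + 2) / (\<eta> * m))"
definition "Vdrift = exp (\<eta> * rdrift2)"
text \<open>Growth rate of the exponent inside the drift radius: noise in each dimension, inflation
  of \<eta>, and the gradient step, which expands |x| by at most 1 + \<gamma> L.\<close>

definition "cdrift = 4 * \<eta> * DIM('a) + \<eta> * (8 * \<eta> + 8 * L) * rdrift2"
definition "Bdrift = (2 * cdrift + crej + 1) * Vdrift"

text \<open>This balance motivates \<eta> = m/16. The gradient step multiplies |x|^2 by at most 1 -
  3 m \<gamma> / 4, the noise inflates the exponent by 1 + 8 \<eta> \<gamma> = 1 + m \<gamma> / 2,
  and the net rate m/4 remains.\<close>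

lemma drift_exponent:
  assumes \<gamma>: "\<gamma> > 0" "\<gamma> * L\<^sup>2 \<le> m / 4" "4 * \<eta> * \<gamma> \<le> 1 / 2"
    and x: "norm x \<ge> 2 * (m + L) * K / m"
  shows "(1 + 8 * \<eta> * \<gamma>) * (norm (x - \<gamma> *\<^sub>R gradU x))\<^sup>2 \<le> (1 - m * \<gamma> / 4) * (norm x)\<^sup>2"
proof -
  define X where "X = (norm x)\<^sup>2"
  have X: "0 \<le> X" by (simp add: X_def)
  have "(m + L) * K \<le> m / 2 * norm x" using x m by (simp add: field_simps)
  then have "(m + L) * K * norm x \<le> m / 2 * norm x * norm x" by (rule mult_right_mono) simp
  then have rad: "m / 2 * X \<le> gradU x \<bullet> x"
    using gradU_radial[of 1 x] by (simp add: X_def power2_eq_square algebra_simps)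
  have "(norm (gradU x))\<^sup>2 \<le> (L * norm x)\<^sup>2" using norm_gradU by (intro power_mono) auto
  then have "\<gamma> * (\<gamma> * (norm (gradU x))\<^sup>2) \<le> \<gamma> * (\<gamma> * (L\<^sup>2 * X))"
    using \<gamma> by (intro mult_left_mono) (auto simp: X_def power_mult_distrib)
  also have "\<dots> \<le> \<gamma> * (m / 4 * X)"
    using \<gamma> X mult_right_mono[OF \<gamma>(2) X] by (intro mult_left_mono) (auto simp: ac_simps)
  finally have q: "\<gamma> * (\<gamma> * (norm (gradU x))\<^sup>2) \<le> \<gamma> * (m / 4 * X)" .
  have "(norm (x - \<gamma> *\<^sub>R gradU x))\<^sup>2 = X - 2 * \<gamma> * (gradU x \<bullet> x) + \<gamma> * (\<gamma> * (norm (gradU x))\<^sup>2)"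
    unfolding X_def power2_norm_eq_inner
    by (simp add: inner_diff_left inner_diff_right inner_commute algebra_simps)
  also have "\<dots> \<le> X - 2 * \<gamma> * (m / 2 * X) + \<gamma> * (m / 4 * X)"
    using q \<gamma>(1) by (intro add_mono diff_left_mono mult_left_mono rad) auto
  finally have c: "(norm (x - \<gamma> *\<^sub>R gradU x))\<^sup>2 \<le> (1 - 3 * m * \<gamma> / 4) * X"
    by (simp add: algebra_simps)
  have "(1 + 8 * \<eta> * \<gamma>) * (norm (x - \<gamma> *\<^sub>R gradU x))\<^sup>2 \<le> (1 + 8 * \<eta> * \<gamma>) * ((1 - 3 * m * \<gamma> / 4) * X)"
    using \<gamma> \<eta>_pos by (intro mult_left_mono c) auto
  also have "\<dots> = (1 - m * \<gamma> / 4) * X - (3 / 8) * (m * \<gamma>)\<^sup>2 * X"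
    by (simp add: \<eta>_def field_simps power2_eq_square)
  also have "\<dots> \<le> (1 - m * \<gamma> / 4) * X" using X by simp
  finally show ?thesis by (simp add: X_def)
qed


text \<open>Accepted moves are bounded by the full proposal, rejected ones by \<open>rej_le\<close>.
  The additive term carries the factor \<gamma>, which is what keeps its accumulation over many
  small steps bounded independently of \<gamma>.\<close>

lemma drift_nn:
  assumes \<gamma>: "\<gamma> > 0" "\<gamma> * L \<le> 1 / 4" "\<gamma> * L\<^sup>2 \<le> m / 4" "4 * \<eta> * \<gamma> \<le> 1 / 2"
    and \<gamma>': "\<gamma> \<le> 1" "\<gamma> * (2 * crej + 2) \<le> 1" "\<gamma> * cdrift \<le> 1"
  shows "(\<integral>\<^sup>+y. ennreal (V y) \<partial>mala_kernel U gradU \<gamma> x) \<le> ennreal ((1 - \<gamma>) * V x + Bdrift * \<gamma>)"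
proof -
  interpret mala_chain U gradU \<gamma> by (rule mala_chain[OF \<gamma>(1)])
  define X where "X = (norm x)\<^sup>2"
  have X: "0 \<le> X" by (simp add: X_def)
  define C where "C = (norm (x - \<gamma> *\<^sub>R gradU x))\<^sup>2"
  have Vx: "V x = exp (\<eta> * X)" by (simp add: V_def X_def)
  define Q where "Q = exp (4 * \<eta> * DIM('a) * \<gamma> + \<eta> * (1 + 8 * \<eta> * \<gamma>) * C)"
  have rd: "0 \<le> rdrift2" by (simp add: rdrift2_def le_max_iff_disj)
  have cd: "0 \<le> cdrift" using rd \<eta>_pos L m by (simp add: cdrift_def)
  have B: "0 \<le> Bdrift" using cd crej_nonneg by (simp add: Bdrift_def Vdrift_def)
  have "\<gamma> * L\<^sup>2 \<le> m" using \<gamma>(3) m by simp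
  note rej = rej_le[OF \<gamma>(1,2) this, of x]
  have "(\<integral>\<^sup>+y. ennreal (V y) \<partial>N x)
     = (\<integral>\<^sup>+y. ennreal (V y) * ennreal (\<alpha> x y * r x y) \<partial>lborel) + ennreal (V x) * rej x"
    by (rule nn_integral_kernel) measurable
  also have "\<dots> \<le> (\<integral>\<^sup>+y. ennreal (V y) * ennreal (r x y) \<partial>lborel) + ennreal (V x) * ennreal (crej * \<gamma>)"
    using \<alpha>_le_1 r_pos \<alpha>_nonneg
    by (intro add_mono nn_integral_mono mult_left_mono ennreal_leI rej)
       (auto intro: mult_left_le_one_le less_imp_le)
  also have "\<dots> \<le> ennreal Q + ennreal (V x) * ennreal (crej * \<gamma>)"
    unfolding Q_def C_def by (intro add_right_mono nn_integral_V_prop[OF \<gamma>(1,4)])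
  also have "\<dots> = ennreal (Q + V x * (crej * \<gamma>))"
    using crej_nonneg \<gamma> V_pos[of x]
    by (subst ennreal_mult[symmetric]) (auto simp: Q_def simp flip: ennreal_plus)
  also have "\<dots> \<le> ennreal ((1 - \<gamma>) * V x + Bdrift * \<gamma>)"
  proof (rule ennreal_leI, cases "rdrift2 \<le> X")
    case True
    have "2 * (m + L) * K / m \<le> norm x"
    proof (rule power2_le_imp_le)
      show "(2 * (m + L) * K / m)\<^sup>2 \<le> (norm x)\<^sup>2"
        using True by (simp add: rdrift2_def X_def)
    qed simp
    from drift_exponent[OF \<gamma>(1,3,4) this]
    have "(1 + 8 * \<eta> * \<gamma>) * C \<le> (1 - m * \<gamma> / 4) * X" by (simp add: C_def X_def)
    then have "\<eta> * ((1 + 8 * \<eta> * \<gamma>) * C) \<le> \<eta> * ((1 - m * \<gamma> / 4) * X)"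
      using \<eta>_pos by (intro mult_left_mono) auto
    moreover have "4 * (4 * \<eta> * DIM('a) + 2 * crej + 2) / (\<eta> * m) \<le> X"
      using True by (simp add: rdrift2_def)
    then have "4 * \<eta> * DIM('a) + (2 * crej + 2) \<le> \<eta> * m * X / 4"
      using \<eta>_pos m by (simp add: divide_le_eq ac_simps)
    then have "(4 * \<eta> * DIM('a) + (2 * crej + 2)) * \<gamma> \<le> \<eta> * m * X / 4 * \<gamma>"
      using \<gamma>(1) by (intro mult_right_mono) auto
    ultimately have "4 * \<eta> * DIM('a) * \<gamma> + \<eta> * (1 + 8 * \<eta> * \<gamma>) * C \<le> \<eta> * X + - (\<gamma> * (2 * crej + 2))"
      by (simp add: algebra_simps)
    then have "Q \<le> V x * exp (- (\<gamma> * (2 * crej + 2)))"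
      unfolding Q_def Vx by (simp flip: exp_add)
    \<comment> \<open>The doubling in 2 crej + 2 is the price of linearising the exponential: exp (-
      u) \<le> 1 - u / 2 for u in [0, 1]. Of the resulting crej + 1, the part crej pays for the
      rejected mass and 1 is left as the drift rate.\<close>
    also have "exp (- (\<gamma> * (2 * crej + 2))) \<le> 1 - \<gamma> * (crej + 1)"
    proof -
      define u where "u = \<gamma> * (2 * crej + 2)"
      have u: "0 \<le> u" "u \<le> 1" using \<gamma> \<gamma>' crej_nonneg by (auto simp: u_def)
      have "exp (- u) \<le> 1 / (1 + u)"
        using exp_ge_add_one_self[of u] u by (simp add: exp_minus inverse_eq_divide frac_le)
      also have "\<dots> \<le> 1 - u / 2"
      proof -
        have "0 \<le> u * (1 - u)" using u by simp
        then show ?thesis using u by (simp add: field_simps)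
      qed
      also have "\<dots> = 1 - \<gamma> * (crej + 1)" by (simp add: u_def algebra_simps)
      finally show ?thesis by (simp add: u_def)
    qed
    finally have "Q \<le> V x * (1 - \<gamma> * (crej + 1))"
      using V_pos[of x] by (simp add: mult_left_mono)
    moreover have "0 \<le> Bdrift * \<gamma>" using B \<gamma> by simp
    ultimately show "Q + V x * (crej * \<gamma>) \<le> (1 - \<gamma>) * V x + Bdrift * \<gamma>"
      by (simp add: algebra_simps)
  next
    case False
    then have Xr: "X \<le> rdrift2" by simp
    have gl: "0 \<le> \<gamma> * L" using \<gamma> L by simp
    have "norm (x - \<gamma> *\<^sub>R gradU x) \<le> norm x + \<gamma> * norm (gradU x)"
      using norm_triangle_ineq4[of x "\<gamma> *\<^sub>R gradU x"] \<gamma> by simp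
    also have "\<dots> \<le> norm x + \<gamma> * (L * norm x)"
      using \<gamma> norm_gradU[of x] by (intro add_left_mono mult_left_mono) auto
    finally have "norm (x - \<gamma> *\<^sub>R gradU x) \<le> (1 + \<gamma> * L) * norm x" by (simp add: algebra_simps)
    then have "C \<le> ((1 + \<gamma> * L) * norm x)\<^sup>2" unfolding C_def by (intro power_mono) auto
    also have "\<dots> = (1 + \<gamma> * L)\<^sup>2 * X" by (simp add: X_def power_mult_distrib)
    also have "(1 + \<gamma> * L)\<^sup>2 \<le> 1 + 3 * (\<gamma> * L)"
      using mult_left_mono[OF \<gamma>(2) gl] gl by (simp add: power2_eq_square algebra_simps)
    finally have "C \<le> (1 + 3 * (\<gamma> * L)) * X" using X by (simp add: mult_right_mono)
    then have "(1 + 8 * \<eta> * \<gamma>) * C \<le> (1 + 8 * \<eta> * \<gamma>) * ((1 + 3 * (\<gamma> * L)) * X)"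
      using \<gamma> \<eta>_pos by (intro mult_left_mono) auto
    also have "\<dots> = ((1 + 8 * \<eta> * \<gamma>) * (1 + 3 * (\<gamma> * L))) * X" by simp
    also have "(1 + 8 * \<eta> * \<gamma>) * (1 + 3 * (\<gamma> * L)) \<le> 1 + \<gamma> * (8 * \<eta> + 8 * L)"
    proof -
      have "8 * \<eta> * \<gamma> * (3 * (\<gamma> * L)) \<le> 1 * (3 * (\<gamma> * L))"
        using \<gamma> gl by (intro mult_right_mono) auto
      then show ?thesis using gl by (simp add: algebra_simps)
    qed
    finally have "(1 + 8 * \<eta> * \<gamma>) * C \<le> (1 + \<gamma> * (8 * \<eta> + 8 * L)) * X"
      using X by (simp add: mult_right_mono)
    also have "\<dots> \<le> X + \<gamma> * (8 * \<eta> + 8 * L) * rdrift2"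
      using Xr \<gamma> \<eta>_pos L by (simp add: distrib_right mult_left_mono)
    finally have "\<eta> * ((1 + 8 * \<eta> * \<gamma>) * C) \<le> \<eta> * (X + \<gamma> * (8 * \<eta> + 8 * L) * rdrift2)"
      using \<eta>_pos by (intro mult_left_mono) auto
    then have "4 * \<eta> * DIM('a) * \<gamma> + \<eta> * (1 + 8 * \<eta> * \<gamma>) * C \<le> \<eta> * X + \<gamma> * cdrift"
      by (simp add: cdrift_def algebra_simps)
    then have "Q \<le> V x * exp (\<gamma> * cdrift)" unfolding Q_def Vx by (simp flip: exp_add)
    also have "\<dots> \<le> V x * (1 + 2 * (\<gamma> * cdrift))"
    proof -
      have u: "0 \<le> \<gamma> * cdrift" using \<gamma> cd by simp
      have "exp (\<gamma> * cdrift) \<le> 1 + \<gamma> * cdrift + (\<gamma> * cdrift)\<^sup>2" by (rule exp_bound[OF u \<gamma>'(3)])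
      also have "\<dots> \<le> 1 + 2 * (\<gamma> * cdrift)"
        using mult_left_mono[OF \<gamma>'(3) u] by (simp add: power2_eq_square)
      finally show ?thesis using V_pos[of x] by simp
    qed
    \<comment> \<open>The summand 1 appears here because \<gamma> V x is split off to leave the
      factor 1 - \<gamma>; inside the drift radius it is absorbed into
      \<open>Bdrift\<close>.\<close>
    finally have "Q + V x * (crej * \<gamma>) \<le> (1 - \<gamma>) * V x + \<gamma> * (2 * cdrift + crej + 1) * V x"
      by (simp add: algebra_simps)
    also have "\<gamma> * (2 * cdrift + crej + 1) * V x \<le> \<gamma> * (2 * cdrift + crej + 1) * Vdrift"
      using Xr \<eta>_pos \<gamma> cd crej_nonneg by (intro mult_left_mono) (auto simp: Vx Vdrift_def)
    finally show "Q + V x * (crej * \<gamma>) \<le> (1 - \<gamma>) * V x + Bdrift * \<gamma>"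
      by (simp add: Bdrift_def algebra_simps)
  qed
  finally show ?thesis .
qed

section \<open>Tails, normalisation and moments of the target\<close>

lemma exp_U_V_le:
  "exp (- U x) * V x \<le> exp (2 * ((m + L) * K)\<^sup>2 / m - U 0) * exp (- (m / 4) * (norm x)\<^sup>2)"
proof -
  define k where "k = (m + L) * K"
  \<comment> \<open>Of the quadratic rate m/2 in \<open>U_lower\<close>, completing this square
    spends m/8 on the linear term and V spends m/16, so at least m/4 remains.\<close>
  have "0 \<le> (m * norm x - 4 * k)\<^sup>2 / (8 * m)" using m by simp
  also have "\<dots> = m / 8 * (norm x)\<^sup>2 + 2 * k\<^sup>2 / m - k * norm x"
    using m by (simp add: power2_diff power_mult_distrib field_simps) (simp add: power2_eq_square)
  finally have "k * norm x \<le> m / 8 * (norm x)\<^sup>2 + 2 * k\<^sup>2 / m" by simp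
  moreover have "U 0 + m / 2 * (norm x)\<^sup>2 - k * norm x \<le> U x" using U_lower[of x] by (simp add: k_def)
  moreover have "0 \<le> m / 16 * (norm x)\<^sup>2" using m by simp
  ultimately have "- U x + \<eta> * (norm x)\<^sup>2 \<le> (2 * k\<^sup>2 / m - U 0) + - (m / 4) * (norm x)\<^sup>2"
    unfolding \<eta>_def by linarith
  then show ?thesis unfolding V_def k_def[symmetric] by (simp flip: exp_add)
qed

lemma nn_integral_exp_U_V: "(\<integral>\<^sup>+x. ennreal (exp (- U x)) * ennreal (V x) \<partial>lborel) < \<infinity>"
proof -
  define c where "c = exp (2 * ((m + L) * K)\<^sup>2 / m - U 0)"
  have "(\<integral>\<^sup>+x. ennreal (exp (- U x)) * ennreal (V x) \<partial>lborel)
    \<le> (\<integral>\<^sup>+x. ennreal c * ennreal (exp (- (m / 4) * (norm (x - 0 :: 'a))\<^sup>2)) \<partial>lborel)"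
  proof (intro nn_integral_mono)
    fix x :: 'a
    show "ennreal (exp (- U x)) * ennreal (V x) \<le> ennreal c * ennreal (exp (- (m / 4) * (norm (x - 0 :: 'a))\<^sup>2))"
      using exp_U_V_le[of x] V_pos[of x]
      by (simp add: c_def less_imp_le flip: ennreal_mult)
  qed
  also have "\<dots> = ennreal c * ennreal ((pi / (m / 4)) powr (real DIM('a) / 2))"
    using m by (subst nn_integral_cmult, measurable) (subst nn_integral_gaussian, auto)
  also have "\<dots> < \<infinity>" by (simp add: ennreal_mult_less_top)
  finally show ?thesis .
qed

lemma measurable_U [measurable]: "U \<in> borel_measurable borel"
  by (intro borel_measurable_continuous_onI continuous_U)

lemma U_quadratic: "\<bar>U x - U 0\<bar> \<le> L / 2 * (norm x)\<^sup>2"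
  using taylor_abs[of x 0] by (simp add: grad0)

text \<open>\<open>target U\<close> divides in \<open>ennreal\<close>, where a denominator 0 or
  \<infinity> would give a density constantly \<infinity> or 0.\<close>

lemma partition_function:
  defines "Z \<equiv> (\<integral>\<^sup>+ x. ennreal (exp (- U x)) \<partial>lborel)"
  shows "Z \<noteq> 0" "Z \<noteq> \<infinity>"
proof -
  have "Z \<le> (\<integral>\<^sup>+x. ennreal (exp (- U x)) * ennreal (V x) \<partial>lborel)"
    unfolding Z_def using V_ge_1
    by (intro nn_integral_mono) (auto simp flip: ennreal_mult' intro!: ennreal_leI)
  then show "Z \<noteq> \<infinity>" using nn_integral_exp_U_V by auto
  \<comment> \<open>The rate L/2 + 1 is visibly positive from L \<ge> 0, as the Gaussian integral
    demands.\<close>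
  have "ennreal (exp (- U 0)) * ennreal ((pi / (L / 2 + 1)) powr (real DIM('a) / 2))
    = (\<integral>\<^sup>+x. ennreal (exp (- U 0)) * ennreal (exp (- (L / 2 + 1) * (norm (x - 0 :: 'a))\<^sup>2)) \<partial>lborel)"
    using L by (subst nn_integral_cmult) (auto simp only: nn_integral_gaussian add_nonneg_pos, auto)
  also have "\<dots> \<le> Z"
    unfolding Z_def
  proof (intro nn_integral_mono)
    fix x :: 'a
    have "U x \<le> U 0 + (L / 2 + 1) * (norm x)\<^sup>2"
      using U_quadratic[of x] zero_le_power2[of "norm x"] by (simp only: distrib_right abs_le_iff) linarith
    then show "ennreal (exp (- U 0)) * ennreal (exp (- (L / 2 + 1) * (norm (x - 0))\<^sup>2)) \<le> ennreal (exp (- U x))"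
      by (simp flip: ennreal_mult exp_add) (simp add: algebra_simps)
  qed
  finally have "ennreal (exp (- U 0) * (pi / (L / 2 + 1)) powr (real DIM('a) / 2)) \<le> Z"
    by (simp add: ennreal_mult)
  moreover have "0 < exp (- U 0) * (pi / (L / 2 + 1)) powr (real DIM('a) / 2)"
    using L by (auto intro!: mult_pos_pos simp: powr_def)
  ultimately show "Z \<noteq> 0" by (auto simp: ennreal_eq_0_iff)
qed

lemma prob_space_target: "prob_space (target U)"
proof
  have "emeasure (target U) (space (target U))
    = (\<integral>\<^sup>+ x. ennreal (exp (- U x)) / (\<integral>\<^sup>+ y. ennreal (exp (- U y)) \<partial>lborel) \<partial>lborel)"
    unfolding target_def by (subst emeasure_density) auto
  also have "\<dots> = 1"
    using partition_function by (subst nn_integral_divide) (auto simp: ennreal_divide_self less_top[symmetric])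
  finally show "emeasure (target U) (space (target U)) = 1" .
qed

lemma sets_target [simp, measurable_cong]: "sets (target U) = sets borel"
  by (simp add: target_def)

lemma nn_integral_target_V: "(\<integral>\<^sup>+x. ennreal (V x) \<partial>target U) < \<infinity>"
proof -
  have "(\<integral>\<^sup>+x. ennreal (V x) \<partial>target U)
    = (\<integral>\<^sup>+ x. (ennreal (exp (- U x)) * ennreal (V x)) / (\<integral>\<^sup>+ y. ennreal (exp (- U y)) \<partial>lborel) \<partial>lborel)"
    unfolding target_def by (subst nn_integral_density) (auto simp: divide_ennreal_def ac_simps)
  also have "\<dots> = (\<integral>\<^sup>+ x. ennreal (exp (- U x)) * ennreal (V x) \<partial>lborel) / (\<integral>\<^sup>+ y. ennreal (exp (- U y)) \<partial>lborel)"
    by (rule nn_integral_divide) measurable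
  also have "\<dots> < \<infinity>"
    using nn_integral_exp_U_V partition_function(1)
    unfolding infinity_ennreal_def less_top[symmetric] ennreal_divide_eq_top_iff by simp
  finally show ?thesis .
qed

end

section \<open>Minorization over unit time\<close>

context smooth_potential
begin

text \<open>The rates of the Gaussian lower bound: \<open>pivot\<close> is the rate 1 / (4 \<gamma>)
  of the proposal plus the Taylor error L/4, and \<open>pot\<close> comes from \<gamma> |gradU x|^2
  / 4 \<le> \<gamma> L^2 |x|^2 / 4.\<close>

definition pivot :: "real \<Rightarrow> real" where "pivot \<gamma> = 1 / (4 * \<gamma>) + L / 4"
definition pot :: "real \<Rightarrow> real" where "pot \<gamma> = \<gamma> * L\<^sup>2 / 4"
text \<open>Loss of mass per unit time: L from expressing the normalising constant through
  \<open>pivot\<close>, and 2 L^2 from integrating against the potential.\<close>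

definition "\<kappa> = real DIM('a) / 2 * (L + 2 * L\<^sup>2)"

definition step_lower :: "real \<Rightarrow> 'a \<Rightarrow> 'a \<Rightarrow> real" where
  "step_lower \<gamma> x y = exp ((U x - U y) / 2) * (4 * pi * \<gamma>) powr (- real DIM('a) / 2)
     * exp (- (pivot \<gamma> * (norm (y - x))\<^sup>2 + pot \<gamma> * ((norm x)\<^sup>2 + (norm y)\<^sup>2)))"

text \<open>Shaped like an n-fold Gaussian convolution: variances add, hence the rate
  \<open>pivot \<gamma> / n\<close> and the matching prefactor. The potential met at intermediate
  points is moved to the endpoints, hence the factor n on \<open>pot\<close>.\<close>

definition iter_lower :: "real \<Rightarrow> nat \<Rightarrow> 'a \<Rightarrow> 'a \<Rightarrow> real" where
  "iter_lower \<gamma> n x y = exp ((U x - U y) / 2)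
     * (exp (- (\<kappa> * \<gamma> * n)) * (pivot \<gamma> / (pi * n)) powr (real DIM('a) / 2))
     * exp (- (pivot \<gamma> / n * (norm (y - x))\<^sup>2 + n * pot \<gamma> * ((norm x)\<^sup>2 + (norm y)\<^sup>2)))"

text \<open>Expanding the square in the proposal gives the cross term g \<bullet> h / 2, half the
  first-order increment of U. Taylor's formula trades it for (U x - U y) / 2 at the cost L |h|^2 /
  4. The term in |y|^2 makes the remaining exponent symmetric.\<close>

lemma step_lower_le_prop:
  assumes \<gamma>: "\<gamma> > 0"
  shows "step_lower \<gamma> x y \<le> mala_prop gradU \<gamma> x y"
proof -
  define h where "h = y - x"
  define g where "g = gradU x"
  have "(norm (h + \<gamma> *\<^sub>R g))\<^sup>2 = (norm h)\<^sup>2 + 2 * \<gamma> * (g \<bullet> h) + \<gamma>\<^sup>2 * (norm g)\<^sup>2"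
    unfolding power2_norm_eq_inner
    by (simp add: inner_add_left inner_add_right inner_commute power2_eq_square algebra_simps)
  then have e: "- (norm (h + \<gamma> *\<^sub>R g))\<^sup>2 / (4 * \<gamma>)
      = - ((norm h)\<^sup>2 / (4 * \<gamma>)) - (g \<bullet> h) / 2 - \<gamma> / 4 * (norm g)\<^sup>2"
    using \<gamma> by (simp add: field_simps power2_eq_square)
  have "\<bar>U y - U x + g \<bullet> (x - y)\<bar> \<le> L / 2 * (norm h)\<^sup>2"
    using taylor_abs[of y x] by (simp add: g_def h_def norm_minus_commute)
  moreover have "g \<bullet> (x - y) = - (g \<bullet> h)" by (simp add: h_def inner_diff_right)
  ultimately have t: "(U x - U y) / 2 + (g \<bullet> h) / 2 \<le> L / 4 * (norm h)\<^sup>2"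
    using abs_le_D2[OF taylor_abs[of y x]]
    by (simp add: g_def h_def norm_minus_commute field_simps)
  have "(norm g)\<^sup>2 \<le> (L * norm x)\<^sup>2" unfolding g_def using norm_gradU by (intro power_mono) auto
  then have "\<gamma> / 4 * (norm g)\<^sup>2 \<le> \<gamma> / 4 * (L * norm x)\<^sup>2" using \<gamma> by (intro mult_left_mono) auto
  then have gb: "\<gamma> / 4 * (norm g)\<^sup>2 \<le> pot \<gamma> * (norm x)\<^sup>2"
    by (simp add: pot_def power_mult_distrib mult.assoc)
  have py: "0 \<le> pot \<gamma> * (norm y)\<^sup>2" using \<gamma> by (simp add: pot_def)
  have "(U x - U y) / 2 + - (pivot \<gamma> * (norm h)\<^sup>2 + pot \<gamma> * ((norm x)\<^sup>2 + (norm y)\<^sup>2))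
      \<le> - (norm (h + \<gamma> *\<^sub>R g))\<^sup>2 / (4 * \<gamma>)"
  proof -
    have "pivot \<gamma> * (norm h)\<^sup>2 = (norm h)\<^sup>2 / (4 * \<gamma>) + L / 4 * (norm h)\<^sup>2"
      by (simp add: pivot_def distrib_right)
    moreover have "pot \<gamma> * ((norm x)\<^sup>2 + (norm y)\<^sup>2) = pot \<gamma> * (norm x)\<^sup>2 + pot \<gamma> * (norm y)\<^sup>2"
      by (rule distrib_left)
    ultimately show ?thesis
      unfolding e using t gb py by linarith
  qed
  then have "exp ((U x - U y) / 2 + - (pivot \<gamma> * (norm h)\<^sup>2 + pot \<gamma> * ((norm x)\<^sup>2 + (norm y)\<^sup>2)))
      \<le> exp (- (norm (h + \<gamma> *\<^sub>R g))\<^sup>2 / (4 * \<gamma>))" by simp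
  then have "(4 * pi * \<gamma>) powr (- real DIM('a) / 2) * (exp ((U x - U y) / 2) *
      exp (- (pivot \<gamma> * (norm h)\<^sup>2 + pot \<gamma> * ((norm x)\<^sup>2 + (norm y)\<^sup>2))))
      \<le> (4 * pi * \<gamma>) powr (- real DIM('a) / 2) * exp (- (norm (h + \<gamma> *\<^sub>R g))\<^sup>2 / (4 * \<gamma>))"
    unfolding exp_add by (rule mult_left_mono) simp
  then show ?thesis
    unfolding step_lower_def mala_prop_def h_def g_def by (simp only: ac_simps)
qed

text \<open>The factor \<open>exp ((U x - U y) / 2)\<close> makes the bound symmetric with respect to the target, so that
  it survives the minimum in the acceptance step.\<close>

lemma step_lower_le:
  assumes \<gamma>: "\<gamma> > 0"
  shows "step_lower \<gamma> x y \<le> mala_acc U gradU \<gamma> x y * mala_prop gradU \<gamma> x y"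
proof -
  have swap: "exp (- U x) * step_lower \<gamma> x y = exp (- U y) * step_lower \<gamma> y x"
  proof -
    have "exp (- U x) * exp ((U x - U y) / 2) = exp (- U y) * exp ((U y - U x) / 2)"
      by (simp flip: exp_add add: field_simps)
    then show ?thesis
      unfolding step_lower_def by (simp add: norm_minus_commute[of y x] add.commute[of "(norm x)\<^sup>2"])
  qed
  have "exp (- U x) * step_lower \<gamma> x y \<le> min (exp (- U x) * mala_prop gradU \<gamma> x y) (exp (- U y) * mala_prop gradU \<gamma> y x)"
  proof (rule min.boundedI)
    show "exp (- U x) * step_lower \<gamma> x y \<le> exp (- U x) * mala_prop gradU \<gamma> x y"
      by (intro mult_left_mono step_lower_le_prop \<gamma>) simp
    show "exp (- U x) * step_lower \<gamma> x y \<le> exp (- U y) * mala_prop gradU \<gamma> y x"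
      unfolding swap by (intro mult_left_mono step_lower_le_prop \<gamma>) simp
  qed
  then have "exp (- U x) * step_lower \<gamma> x y \<le> exp (- U x) * (mala_acc U gradU \<gamma> x y * mala_prop gradU \<gamma> x y)"
    by (simp only: mala_acc_mult_prop[OF \<gamma>])
  then show ?thesis by simp
qed

lemma step_lower_nonneg: "0 \<le> step_lower \<gamma> x y" and iter_lower_nonneg: "0 \<le> iter_lower \<gamma> n x y"
  by (auto simp: step_lower_def iter_lower_def)

lemma pivot_pos: "\<gamma> > 0 \<Longrightarrow> 0 < pivot \<gamma>"
  using L by (auto simp: pivot_def intro!: add_pos_nonneg)

lemma pot_nonneg: "\<gamma> > 0 \<Longrightarrow> 0 \<le> pot \<gamma>"
  by (simp add: pot_def)

lemma prefactor:
  assumes \<gamma>: "\<gamma> > 0"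
  shows "(4 * pi * \<gamma>) powr (- real DIM('a) / 2)
    = (pivot \<gamma> / pi) powr (real DIM('a) / 2) * (1 + \<gamma> * L) powr (- (real DIM('a) / 2))"
proof -
  define d where "d = real DIM('a) / 2"
  have "pivot \<gamma> / pi = (1 + \<gamma> * L) / (4 * pi * \<gamma>)"
    using \<gamma> by (simp add: pivot_def field_simps)
  moreover have pos: "1 + \<gamma> * L > 0" using \<gamma> L by (simp add: add_pos_nonneg)
  ultimately have "(pivot \<gamma> / pi) powr d = (1 + \<gamma> * L) powr d / (4 * pi * \<gamma>) powr d"
    using \<gamma> by (simp add: powr_divide)
  moreover have "(1 + \<gamma> * L) powr d > 0" using pos by simp
  ultimately have "(4 * pi * \<gamma>) powr (- d) = (pivot \<gamma> / pi) powr d * (1 + \<gamma> * L) powr (- d)"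
    by (simp add: powr_minus inverse_eq_divide)
  then show ?thesis by (simp add: d_def)
qed

lemma iter_lower_1:
  assumes \<gamma>: "\<gamma> > 0"
  shows "iter_lower \<gamma> 1 x y \<le> step_lower \<gamma> x y"
proof -
  define d where "d = real DIM('a) / 2"
  have d: "0 \<le> d" by (simp add: d_def)
  have "exp (- (\<kappa> * \<gamma>)) \<le> exp (- (\<gamma> * L * d))"
    using \<gamma> L d by (simp add: \<kappa>_def d_def[symmetric] algebra_simps)
  also have "\<dots> \<le> (1 + \<gamma> * L) powr (- d)"
    using \<gamma> L d by (intro one_minus_le_powr_neg) auto
  finally have "exp (- (\<kappa> * \<gamma>)) * (pivot \<gamma> / pi) powr d \<le> (4 * pi * \<gamma>) powr (- real DIM('a) / 2)"
    unfolding prefactor[OF \<gamma>] d_def[symmetric] mult.commute[of "exp _"]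
    by (rule mult_left_mono) simp
  then show ?thesis
    unfolding iter_lower_def step_lower_def d_def[symmetric]
    by (intro mult_mono) (auto simp: d_def)
qed

lemma convex_combination_square:
  fixes x y :: 'a
  assumes "n > 0"
  shows "(norm ((1 / (n + 1)) *\<^sub>R x + (n / (n + 1)) *\<^sub>R y))\<^sup>2 \<le> ((norm x)\<^sup>2 + n * (norm y)\<^sup>2) / (n + 1)"
proof -
  define p where "p = 1 / (n + 1)"
  have p: "0 \<le> p" "p \<le> 1" "n / (n + 1) = 1 - p" using assms by (auto simp: p_def field_simps)
  have "(norm (p *\<^sub>R x + (1 - p) *\<^sub>R y))\<^sup>2 = p * (norm x)\<^sup>2 + (1 - p) * (norm y)\<^sup>2 - p * (1 - p) * (norm (x - y))\<^sup>2"
    unfolding power2_norm_eq_inner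
    by (simp add: inner_add_left inner_add_right inner_diff_left inner_diff_right inner_commute algebra_simps)
  also have "\<dots> \<le> p * (norm x)\<^sup>2 + (1 - p) * (norm y)\<^sup>2" using p by simp
  also have "\<dots> = ((norm x)\<^sup>2 + n * (norm y)\<^sup>2) / (n + 1)"
  proof -
    have "(1 - p) * (norm y)\<^sup>2 = n * (norm y)\<^sup>2 / (n + 1)" unfolding p(3)[symmetric] by simp
    then show ?thesis by (simp add: p_def add_divide_distrib)
  qed
  finally show ?thesis unfolding p(3) by (simp add: p_def)
qed

text \<open>Here \<open>zb\<close> is the mean, at the last intermediate time, of the bridge from \<open>x\<close> to \<open>y\<close> in \<open>n + 1\<close> steps.\<close>

lemma bridge_square:
  fixes x y z :: 'a and A n :: real
  assumes "A > 0" "n > 0"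
  defines "A' \<equiv> A * (n + 1) / n"
    and "zb \<equiv> (1 / (n + 1)) *\<^sub>R x + (n / (n + 1)) *\<^sub>R y"
  shows "A / n * (norm (z - x))\<^sup>2 + A * (norm (y - z))\<^sup>2
    = A' * (norm (z - zb))\<^sup>2 + A / (n + 1) * (norm (y - x))\<^sup>2"
proof -
  define p where "p = 1 / (n + 1)"
  define w where "w = A' "
  have n1: "n + 1 \<noteq> 0" using assms by simp
  have p1: "n / (n + 1) = 1 - p" using n1 by (simp add: p_def field_simps)
  have w: "A / n = w * p" "A = w * (n / (n + 1))" "A / (n + 1) = A * p"
    using n1 assms by (simp_all add: p_def w_def A'_def)
  then have p: "n / (n + 1) = 1 - p" "A / n = w * p" "A = w * (1 - p)" "A / (n + 1) = w * (1 - p) * p"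
    unfolding p1 by simp_all
  show ?thesis
    unfolding zb_def p(1) p_def[symmetric] w_def[symmetric] p(2) p(4) unfolding p(3)
    unfolding power2_norm_eq_inner
    by (simp add: inner_add_left inner_add_right inner_diff_left inner_diff_right inner_commute algebra_simps)
qed

text \<open>A Chapman-Kolmogorov inequality. By \<open>bridge_square\<close> the intermediate point
  z is Gaussian around \<open>zb\<close> with rate \<open>A'\<close>; the two potentials acting on
  it add up to the rate \<open>B\<close>, which is integrated exactly.\<close>

lemma iter_lower_Suc:
  assumes \<gamma>: "\<gamma> > 0" and n: "n > 0" "n * \<gamma> \<le> 2"
  shows "ennreal (iter_lower \<gamma> (Suc n) x y)
    \<le> (\<integral>\<^sup>+z. ennreal (iter_lower \<gamma> n x z * step_lower \<gamma> z y) \<partial>lborel)"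
proof -
  define A where "A = pivot \<gamma>"
  define b where "b = pot \<gamma>"
  define d where "d = real DIM('a) / 2"
  define N where "N = real n"
  define E where "E = exp (- (\<kappa> * \<gamma> * n))"
  define A' where "A' = A * (N + 1) / N"
  define B where "B = (N + 1) * b"
  define zb where "zb = (1 / (N + 1)) *\<^sub>R x + (N / (N + 1)) *\<^sub>R y"
  have d: "0 \<le> d" by (simp add: d_def)
  have A: "A > 0" and b: "b \<ge> 0" and N: "N > 0"
    using pivot_pos[OF \<gamma>] pot_nonneg[OF \<gamma>] n by (auto simp: A_def b_def N_def)
  have A': "A' > 0" and B: "B \<ge> 0" using A b N by (auto simp: A'_def B_def)
  define P where "P = (4 * pi * \<gamma>) powr (- real DIM('a) / 2)"
  define G where "G = exp ((U x - U y) / 2) * (E * (A / (pi * N)) powr d) * P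
     * exp (- (A / (N + 1) * (norm (y - x))\<^sup>2 + N * b * (norm x)\<^sup>2 + b * (norm y)\<^sup>2))"
  have G: "0 \<le> G" by (simp add: G_def E_def P_def)
  have prod: "iter_lower \<gamma> n x z * step_lower \<gamma> z y
    = G * exp (- (A' * (norm (z - zb))\<^sup>2 + B * (norm z)\<^sup>2))" for z
  proof -
    have "A / N * (norm (z - x))\<^sup>2 + A * (norm (y - z))\<^sup>2
      = A' * (norm (z - zb))\<^sup>2 + A / (N + 1) * (norm (y - x))\<^sup>2"
      unfolding A'_def zb_def by (rule bridge_square[OF A N])
    then have e: "- (A / N * (norm (z - x))\<^sup>2 + N * b * ((norm x)\<^sup>2 + (norm z)\<^sup>2))
        + - (A * (norm (y - z))\<^sup>2 + b * ((norm z)\<^sup>2 + (norm y)\<^sup>2))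
      = - (A / (N + 1) * (norm (y - x))\<^sup>2 + N * b * (norm x)\<^sup>2 + b * (norm y)\<^sup>2)
        + - (A' * (norm (z - zb))\<^sup>2 + B * (norm z)\<^sup>2)"
      unfolding B_def by (simp add: algebra_simps)
    have u: "exp ((U x - U z) / 2) * exp ((U z - U y) / 2) = exp ((U x - U y) / 2)"
      by (simp flip: exp_add add: diff_divide_distrib)
    have "iter_lower \<gamma> n x z * step_lower \<gamma> z y
      = (exp ((U x - U z) / 2) * exp ((U z - U y) / 2)) * (E * (A / (pi * N)) powr d) * P
        * (exp (- (A / N * (norm (z - x))\<^sup>2 + N * b * ((norm x)\<^sup>2 + (norm z)\<^sup>2)))
          * exp (- (A * (norm (y - z))\<^sup>2 + b * ((norm z)\<^sup>2 + (norm y)\<^sup>2))))"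
      unfolding iter_lower_def step_lower_def A_def b_def N_def E_def P_def d_def by (simp only: ac_simps)
    also have "\<dots> = G * exp (- (A' * (norm (z - zb))\<^sup>2 + B * (norm z)\<^sup>2))"
      unfolding u unfolding exp_add[symmetric] e unfolding exp_add G_def by (simp only: ac_simps)
    finally show ?thesis .
  qed
  have "(\<integral>\<^sup>+z. ennreal (iter_lower \<gamma> n x z * step_lower \<gamma> z y) \<partial>lborel)
    = (\<integral>\<^sup>+z. ennreal G * ennreal (exp (- (A' * (norm (z - zb))\<^sup>2 + B * (norm z)\<^sup>2))) \<partial>lborel)"
    unfolding prod using G by (simp add: ennreal_mult)
  also have "\<dots> = ennreal G * ennreal (exp (- (A' * B / (A' + B) * (norm zb)\<^sup>2)) * (pi / (A' + B)) powr d)"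
    unfolding d_def using A' B
    by (subst nn_integral_cmult) (auto simp only: nn_integral_gaussian_product add_pos_nonneg, simp)
  also have "\<dots> = ennreal (G * (exp (- (A' * B / (A' + B) * (norm zb)\<^sup>2)) * (pi / (A' + B)) powr d))"
    using G by (simp add: ennreal_mult)
  finally have int: "(\<integral>\<^sup>+z. ennreal (iter_lower \<gamma> n x z * step_lower \<gamma> z y) \<partial>lborel)
    = ennreal (G * (exp (- (A' * B / (A' + B) * (norm zb)\<^sup>2)) * (pi / (A' + B)) powr d))" .
  \<comment> \<open>The parallel combination of \<open>A'\<close> and \<open>B\<close> is at most
    \<open>B\<close>, and convexity splits B |zb|^2 into b |x|^2 + N b |y|^2. With the N b |x|^2 + b
    |y|^2 already in \<open>G\<close>, each endpoint receives exactly (N + 1) b.\<close>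
  have ex: "exp (- (b * (norm x)\<^sup>2 + N * b * (norm y)\<^sup>2)) \<le> exp (- (A' * B / (A' + B) * (norm zb)\<^sup>2))"
  proof -
    have "A' * B / (A' + B) \<le> B"
    proof -
      have "0 \<le> B * B" by simp
      then show ?thesis using A' B by (simp add: divide_le_eq algebra_simps)
    qed
    then have "A' * B / (A' + B) * (norm zb)\<^sup>2 \<le> B * (norm zb)\<^sup>2" by (rule mult_right_mono) simp
    also have "\<dots> \<le> B * (((norm x)\<^sup>2 + N * (norm y)\<^sup>2) / (N + 1))"
      unfolding zb_def by (intro mult_left_mono convex_combination_square N B)
    also have "\<dots> = b * (norm x)\<^sup>2 + N * b * (norm y)\<^sup>2"
      using N by (simp add: B_def field_simps)
    finally show ?thesis by simp
  qed
  have pw: "exp (- (\<kappa> * \<gamma>)) * (A / (pi * (N + 1))) powr d \<le> (A / (pi * N)) powr d * P * (pi / (A' + B)) powr d"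
  proof -
    \<comment> \<open>This is B / A', the relative increase of the rate that the potential causes.
      Here n \<gamma> \<le> 2 enters: it makes u of order \<gamma> and not just bounded, so the loss
      can be repeated at every step.\<close>
    define u where "u = N * b / A"
    have u0: "0 \<le> u" using A b N by (simp add: u_def)
    have u: "u \<le> 2 * \<gamma> * L\<^sup>2"
    proof -
      have "1 / (4 * \<gamma>) \<le> A" using L by (simp add: A_def pivot_def)
      then have "1 \<le> A * (4 * \<gamma>)" using \<gamma> by (simp add: divide_le_eq)
      then have "N * b * 1 \<le> N * b * (A * (4 * \<gamma>))" using N b by (intro mult_left_mono) auto
      then have "u \<le> N * b * (4 * \<gamma>)" using A by (simp add: u_def divide_le_eq ac_simps)
      also have "\<dots> = (n * \<gamma>) * (\<gamma> * L\<^sup>2)" by (simp add: b_def pot_def N_def)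
      also have "\<dots> \<le> 2 * (\<gamma> * L\<^sup>2)" using n \<gamma> by (intro mult_right_mono) auto
      finally show ?thesis by simp
    qed
    have "pi / (A' + B) = (pi * N / (A * (N + 1))) / (1 + u)"
    proof -
      have "A' + B = (A * (N + 1) / N) * (1 + u)"
        using A N by (simp add: A'_def B_def u_def field_simps)
      then show ?thesis by (simp add: ac_simps)
    qed
    then have 1: "(pi / (A' + B)) powr d = (pi * N / (A * (N + 1))) powr d * (1 + u) powr (- d)"
      using A N u0 by (simp add: powr_divide powr_minus inverse_eq_divide powr_mult)
    have "exp (- (\<kappa> * \<gamma>)) = exp (- (\<gamma> * L * d)) * exp (- (2 * \<gamma> * L\<^sup>2 * d))"
      unfolding exp_add[symmetric] \<kappa>_def d_def[symmetric] by (simp add: algebra_simps)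
    also have "\<dots> \<le> exp (- (\<gamma> * L * d)) * exp (- (u * d))"
      using mult_right_mono[OF u d] by simp
    also have "\<dots> \<le> (1 + \<gamma> * L) powr (- d) * (1 + u) powr (- d)"
      using \<gamma> L d u0 by (intro mult_mono one_minus_le_powr_neg) auto
    finally have 2: "exp (- (\<kappa> * \<gamma>)) \<le> (1 + \<gamma> * L) powr (- d) * (1 + u) powr (- d)" .
    have 3: "(A / (pi * N)) powr d * (A / pi) powr d * (pi * N / (A * (N + 1))) powr d = (A / (pi * (N + 1))) powr d"
    proof -
      have "(A / (pi * N)) powr d * (A / pi) powr d * (pi * N / (A * (N + 1))) powr d
        = (A / (pi * N) * (A / pi) * (pi * N / (A * (N + 1)))) powr d"
        by (simp only: powr_mult)
      also have "A / (pi * N) * (A / pi) * (pi * N / (A * M)) = A / (pi * M)" if "M > 0" for M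
        using A N that by (simp add: field_simps)
      then have "A / (pi * N) * (A / pi) * (pi * N / (A * (N + 1))) = A / (pi * (N + 1))"
        using N by simp
      finally show ?thesis .
    qed
    have "exp (- (\<kappa> * \<gamma>)) * (A / (pi * (N + 1))) powr d
      \<le> ((1 + \<gamma> * L) powr (- d) * (1 + u) powr (- d)) * (A / (pi * (N + 1))) powr d"
      by (rule mult_right_mono[OF 2]) simp
    also have "\<dots> = (A / (pi * N)) powr d * ((A / pi) powr d * (1 + \<gamma> * L) powr (- d)) * ((pi * N / (A * (N + 1))) powr d * (1 + u) powr (- d))"
      unfolding 3[symmetric] by (simp only: ac_simps)
    also have "\<dots> = (A / (pi * N)) powr d * P * (pi / (A' + B)) powr d"
      unfolding 1 P_def prefactor[OF \<gamma>] A_def[symmetric] d_def[symmetric] ..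
    finally show ?thesis .
  qed
  have S: "real (Suc n) = N + 1" by (simp add: N_def)
  have Esuc: "exp (- (\<kappa> * \<gamma> * (N + 1))) = E * exp (- (\<kappa> * \<gamma>))"
    unfolding E_def exp_add[symmetric] N_def[symmetric] by (simp add: algebra_simps)
  define F where "F = exp (- (A / (N + 1) * (norm (y - x))\<^sup>2 + N * b * (norm x)\<^sup>2 + b * (norm y)\<^sup>2))"
  have Fsuc: "exp (- (A / (N + 1) * (norm (y - x))\<^sup>2 + (N + 1) * b * ((norm x)\<^sup>2 + (norm y)\<^sup>2)))
      = F * exp (- (b * (norm x)\<^sup>2 + N * b * (norm y)\<^sup>2))"
    unfolding F_def exp_add[symmetric] by (simp add: algebra_simps)
  have "iter_lower \<gamma> (Suc n) x y = exp ((U x - U y) / 2) * E * F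
      * ((exp (- (\<kappa> * \<gamma>)) * (A / (pi * (N + 1))) powr d) * exp (- (b * (norm x)\<^sup>2 + N * b * (norm y)\<^sup>2)))"
    unfolding iter_lower_def S A_def[symmetric] b_def[symmetric] d_def[symmetric] Esuc Fsuc
    by (simp only: ac_simps)
  also have "\<dots> \<le> exp ((U x - U y) / 2) * E * F
      * (((A / (pi * N)) powr d * P * (pi / (A' + B)) powr d) * exp (- (A' * B / (A' + B) * (norm zb)\<^sup>2)))"
    by (intro mult_left_mono mult_mono pw ex) (auto simp: E_def F_def P_def)
  also have "\<dots> = G * (exp (- (A' * B / (A' + B) * (norm zb)\<^sup>2)) * (pi / (A' + B)) powr d)"
    unfolding G_def F_def by (simp only: ac_simps)
  finally show ?thesis unfolding int by (rule ennreal_leI)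
qed

lemma step_lower_measurable [measurable]:
  assumes [measurable]: "f \<in> M \<rightarrow>\<^sub>M borel" "g \<in> M \<rightarrow>\<^sub>M borel"
  shows "(\<lambda>z. step_lower \<gamma> (f z) (g z)) \<in> borel_measurable M"
    and "(\<lambda>z. iter_lower \<gamma> n (f z) (g z)) \<in> borel_measurable M"
  unfolding step_lower_def iter_lower_def by measurable

text \<open>Stated for functions because the induction applies its hypothesis to the one-step
  expectation of f. At each step the atom left by rejection is dropped.\<close>

lemma nn_integral_iter_lower:
  assumes \<gamma>: "\<gamma> > 0" and n: "n > 0" "n * \<gamma> \<le> 2"
    and f: "f \<in> borel_measurable borel"
  shows "(\<integral>\<^sup>+y. f y * ennreal (iter_lower \<gamma> n x y) \<partial>lborel) \<le> (\<integral>\<^sup>+y. f y \<partial>mala_iter U gradU \<gamma> n x)"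
  using n f
proof (induction n arbitrary: f rule: nat_induct_non_zero)
  interpret mala_chain U gradU \<gamma> by (rule mala_chain[OF \<gamma>])
  have step: "(\<integral>\<^sup>+y. f y * ennreal (step_lower \<gamma> x y) \<partial>lborel) \<le> (\<integral>\<^sup>+y. f y \<partial>N x)"
    if [measurable]: "f \<in> borel_measurable borel" for f x
  proof -
    have "(\<integral>\<^sup>+y. f y * ennreal (step_lower \<gamma> x y) \<partial>lborel)
       \<le> (\<integral>\<^sup>+y. f y * ennreal (\<alpha> x y * r x y) \<partial>lborel) + 0"
      using step_lower_le[OF \<gamma>] by (simp add: nn_integral_mono mult_left_mono ennreal_leI)
    also have "\<dots> \<le> (\<integral>\<^sup>+y. f y \<partial>N x)"
      unfolding nn_integral_kernel[OF that] by (intro add_left_mono) simp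
    finally show ?thesis .
  qed
  {
    case 1
    note [measurable] = 1(2)
    have "(\<integral>\<^sup>+y. f y * ennreal (iter_lower \<gamma> 1 x y) \<partial>lborel)
       \<le> (\<integral>\<^sup>+y. f y * ennreal (step_lower \<gamma> x y) \<partial>lborel)"
      by (intro nn_integral_mono mult_left_mono ennreal_leI iter_lower_1 \<gamma>) simp
    also have "\<dots> \<le> (\<integral>\<^sup>+y. f y \<partial>N x)" by (rule step) measurable
    also have "\<dots> = (\<integral>\<^sup>+y. f y \<partial>iter 1 x)"
      unfolding One_nat_def nn_integral_iter_Suc[OF 1(2)] by (simp add: nn_integral_return)
    finally show ?case .
  next
    case (Suc n)
    note [measurable] = Suc.prems(2)
    have n\<gamma>: "n * \<gamma> \<le> 2" using Suc.prems(1) \<gamma> by (simp add: algebra_simps)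
    have "(\<integral>\<^sup>+y. f y * ennreal (iter_lower \<gamma> (Suc n) x y) \<partial>lborel)
       \<le> (\<integral>\<^sup>+y. f y * (\<integral>\<^sup>+z. ennreal (iter_lower \<gamma> n x z * step_lower \<gamma> z y) \<partial>lborel) \<partial>lborel)"
      by (intro nn_integral_mono mult_left_mono iter_lower_Suc \<gamma> Suc.hyps n\<gamma>) simp
    also have "\<dots> = (\<integral>\<^sup>+y. \<integral>\<^sup>+z. f y * ennreal (iter_lower \<gamma> n x z * step_lower \<gamma> z y) \<partial>lborel \<partial>lborel)"
      by (simp add: nn_integral_cmult)
    also have "\<dots> = (\<integral>\<^sup>+z. \<integral>\<^sup>+y. f y * ennreal (iter_lower \<gamma> n x z * step_lower \<gamma> z y) \<partial>lborel \<partial>lborel)"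
      by (subst lborel_pair.Fubini') auto
    also have "\<dots> = (\<integral>\<^sup>+z. \<integral>\<^sup>+y. (f y * ennreal (step_lower \<gamma> z y)) * ennreal (iter_lower \<gamma> n x z) \<partial>lborel \<partial>lborel)"
      by (intro nn_integral_cong)
         (subst ennreal_mult[OF iter_lower_nonneg step_lower_nonneg], simp only: ac_simps)
    also have "\<dots> = (\<integral>\<^sup>+z. (\<integral>\<^sup>+y. f y * ennreal (step_lower \<gamma> z y) \<partial>lborel) * ennreal (iter_lower \<gamma> n x z) \<partial>lborel)"
      by (simp add: nn_integral_multc)
    also have "\<dots> \<le> (\<integral>\<^sup>+z. (\<integral>\<^sup>+y. f y \<partial>N z) * ennreal (iter_lower \<gamma> n x z) \<partial>lborel)"
      by (intro nn_integral_mono mult_right_mono step) simp_all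
    also have "\<dots> \<le> (\<integral>\<^sup>+z. (\<integral>\<^sup>+y. f y \<partial>N z) \<partial>iter n x)"
      by (rule Suc.IH[OF n\<gamma>]) measurable
    also have "\<dots> = (\<integral>\<^sup>+y. f y \<partial>iter (Suc n) x)"
      by (rule nn_integral_iter_Suc[symmetric]) measurable
    finally show ?case .
  }
qed

end

section \<open>Uniform geometric ergodicity\<close>

context smooth_potential
begin

definition small_step :: "real \<Rightarrow> bool" where
  "small_step \<gamma> \<longleftrightarrow> \<gamma> > 0 \<and> \<gamma> * L \<le> 1 / 4 \<and> \<gamma> * L\<^sup>2 \<le> m / 4 \<and> 4 * \<eta> * \<gamma> \<le> 1 / 2
     \<and> \<gamma> \<le> 1 \<and> \<gamma> * (2 * crej + 2) \<le> 1 \<and> \<gamma> * cdrift \<le> 1"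

lemma ex_small_step: "\<exists>\<Gamma>>0. \<forall>\<gamma>\<in>{0<..\<Gamma>}. small_step \<gamma>"
proof -
  have *: "\<forall>\<^sub>F \<gamma> in at_right 0. \<gamma> * a \<le> b" if "b > 0" for a b :: real
  proof -
    have "((\<lambda>\<gamma>. \<gamma> * a) \<longlongrightarrow> 0 * a) (at_right 0)" by (intro tendsto_intros)
    then have "\<forall>\<^sub>F \<gamma> in at_right 0. \<gamma> * a < b" using that by (intro order_tendstoD) auto
    then show ?thesis by eventually_elim simp
  qed
  have "\<forall>\<^sub>F \<gamma> in at_right 0. \<gamma> * L \<le> 1 / 4" "\<forall>\<^sub>F \<gamma> in at_right 0. \<gamma> * L\<^sup>2 \<le> m / 4"
    "\<forall>\<^sub>F \<gamma> in at_right 0. \<gamma> * (4 * \<eta>) \<le> 1 / 2" "\<forall>\<^sub>F \<gamma> in at_right 0. \<gamma> * 1 \<le> (1 :: real)"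
    "\<forall>\<^sub>F \<gamma> in at_right 0. \<gamma> * (2 * crej + 2) \<le> 1" "\<forall>\<^sub>F \<gamma> in at_right 0. \<gamma> * cdrift \<le> 1"
    by (rule *, use m in simp)+
  then have "\<forall>\<^sub>F \<gamma> in at_right 0. small_step \<gamma>"
    using eventually_at_right_less[of 0]
    unfolding small_step_def by eventually_elim (auto simp: ac_simps)
  then obtain b where "b > 0" "\<And>y. 0 < y \<Longrightarrow> y < b \<Longrightarrow> small_step y"
    by (auto simp: eventually_at_right_field)
  then show ?thesis by (intro exI[of _ "b / 2"]) auto
qed

lemma Bdrift_nonneg: "0 \<le> Bdrift"
proof -
  have "0 \<le> rdrift2" by (simp add: rdrift2_def le_max_iff_disj)
  then have "0 \<le> cdrift" using \<eta>_pos L m by (simp add: cdrift_def)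
  then show ?thesis using crej_nonneg by (simp add: Bdrift_def Vdrift_def)
qed

text \<open>\<open>Bdrift\<close> is the fixed point of b \<mapsto> (1 - \<gamma>) b + Bdrift
  \<gamma>, so the additive constant is the same for all n and \<gamma>.\<close>

lemma drift_iter_nn:
  assumes \<gamma>: "small_step \<gamma>"
  shows "(\<integral>\<^sup>+y. ennreal (V y) \<partial>mala_iter U gradU \<gamma> n x) \<le> ennreal ((1 - \<gamma>) ^ n * V x + Bdrift)"
proof (induction n)
  case 0
  have "V x \<le> V x + Bdrift" using Bdrift_nonneg by simp
  then show ?case by (simp add: nn_integral_return ennreal_leI)
next
  case (Suc n)
  interpret mala_chain U gradU \<gamma> using \<gamma> by (intro mala_chain) (simp add: small_step_def)
  interpret P: prob_space "iter n x" by (rule prob_space_iter)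
  have g: "0 < \<gamma>" "\<gamma> \<le> 1" using \<gamma> by (auto simp: small_step_def)
  have "(\<integral>\<^sup>+y. ennreal (V y) \<partial>iter (Suc n) x) = (\<integral>\<^sup>+z. \<integral>\<^sup>+y. ennreal (V y) \<partial>N z \<partial>iter n x)"
    by (rule nn_integral_iter_Suc) measurable
  also have "\<dots> \<le> (\<integral>\<^sup>+z. ennreal ((1 - \<gamma>) * V z + Bdrift * \<gamma>) \<partial>iter n x)"
    using \<gamma> unfolding small_step_def by (intro nn_integral_mono drift_nn) auto
  also have "\<dots> = (\<integral>\<^sup>+z. ennreal (1 - \<gamma>) * ennreal (V z) + ennreal (Bdrift * \<gamma>) \<partial>iter n x)"
    using g Bdrift_nonneg V_pos by (intro nn_integral_cong) (simp add: ennreal_mult less_imp_le)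
  also have "\<dots> = ennreal (1 - \<gamma>) * (\<integral>\<^sup>+z. ennreal (V z) \<partial>iter n x) + ennreal (Bdrift * \<gamma>)"
    using P.emeasure_space_1 by (simp add: nn_integral_add nn_integral_cmult)
  also have "\<dots> \<le> ennreal (1 - \<gamma>) * ennreal ((1 - \<gamma>) ^ n * V x + Bdrift) + ennreal (Bdrift * \<gamma>)"
    by (intro add_right_mono mult_left_mono Suc) simp
  also have "\<dots> = ennreal ((1 - \<gamma>) * ((1 - \<gamma>) ^ n * V x + Bdrift) + Bdrift * \<gamma>)"
    using g Bdrift_nonneg V_pos[of x]
    by (subst ennreal_mult[symmetric]) (auto intro!: add_nonneg_nonneg simp flip: ennreal_plus)
  also have "(1 - \<gamma>) * ((1 - \<gamma>) ^ n * V x + Bdrift) + Bdrift * \<gamma> = (1 - \<gamma>) ^ Suc n * V x + Bdrift"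
    by (simp add: algebra_simps)
  finally show ?case .
qed

lemma V_iter:
  assumes \<gamma>: "small_step \<gamma>"
  shows "integrable (mala_iter U gradU \<gamma> n x) V"
    and "(\<integral>y. V y \<partial>mala_iter U gradU \<gamma> n x) \<le> (1 - \<gamma>) ^ n * V x + Bdrift"
proof -
  interpret mala_chain U gradU \<gamma> using \<gamma> by (intro mala_chain) (simp add: small_step_def)
  have g: "0 < \<gamma>" "\<gamma> \<le> 1" using \<gamma> by (auto simp: small_step_def)
  show int: "integrable (iter n x) V"
    using drift_iter_nn[OF \<gamma>, of n x] V_pos
    by (intro integrableI_nonneg) (auto intro: less_imp_le le_less_trans)
  have "ennreal (\<integral>y. V y \<partial>iter n x) = (\<integral>\<^sup>+y. ennreal (V y) \<partial>iter n x)"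
    using V_pos by (intro nn_integral_eq_integral[OF int, symmetric]) (auto intro: less_imp_le)
  also have "\<dots> \<le> ennreal ((1 - \<gamma>) ^ n * V x + Bdrift)" by (rule drift_iter_nn[OF \<gamma>])
  finally show "(\<integral>y. V y \<partial>iter n x) \<le> (1 - \<gamma>) ^ n * V x + Bdrift"
    using g Bdrift_nonneg V_pos[of x] by (subst (asm) ennreal_le_iff) auto
qed

lemma V_iter_le:
  assumes \<gamma>: "small_step \<gamma>"
  shows "(\<integral>y. V y \<partial>mala_iter U gradU \<gamma> n x) \<le> V x + Bdrift"
proof -
  have "(1 - \<gamma>) ^ n \<le> 1" using \<gamma> by (intro power_le_one) (auto simp: small_step_def)
  then have "(1 - \<gamma>) ^ n * V x \<le> V x" using V_pos[of x] by (intro mult_left_le_one_le) (use \<gamma> in \<open>auto simp: small_step_def\<close>)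
  then show ?thesis using V_iter(2)[OF \<gamma>, of n x] by simp
qed

text \<open>The leading part of \<open>pivot \<gamma> / n\<close> is 1 / (4 n \<gamma>), which lies
  between 1/8 and 1/4: the lower value bounds the prefactor, the upper one the exponent. The other
  factors depend on \<gamma> through n \<gamma> \<le> 2, so \<gamma> disappears.\<close>

lemma iter_lower_unit_time:
  fixes X :: real
  defines "e \<equiv> exp (- (L / 4 * (X + 1))) * (exp (- (2 * \<kappa>)) * (1 / (8 * pi)) powr (real DIM('a) / 2))
     * exp (- ((1 / 4 + L / 4) * (2 * X + 2) + L\<^sup>2 / 2 * (X + 1)))"
  assumes \<gamma>: "\<gamma> > 0" and n: "1 \<le> n * \<gamma>" "n * \<gamma> \<le> 2"
    and x: "(norm x)\<^sup>2 \<le> X" and y: "norm y \<le> 1"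
  shows "e \<le> iter_lower \<gamma> n x y"
  unfolding e_def iter_lower_def
proof (intro mult_mono)
  define d where "d = real DIM('a) / 2"
  have n0: "real n > 0" using n by (cases "n = 0") auto
  have y2: "(norm y)\<^sup>2 \<le> 1" using y by (simp add: power_le_one)
  have X: "0 \<le> X" using x order_trans[OF zero_le_power2] by blast
  have "U y - U x \<le> L / 2 * (norm x)\<^sup>2 + L / 2 * (norm y)\<^sup>2"
    using abs_le_D2[OF U_quadratic[of x]] abs_le_D1[OF U_quadratic[of y]] by linarith
  also have "\<dots> \<le> L / 2 * X + L / 2 * 1" using x y2 L by (intro add_mono mult_left_mono) auto
  finally show "exp (- (L / 4 * (X + 1))) \<le> exp ((U x - U y) / 2)"
    by (simp add: field_simps)
  have "\<kappa> \<ge> 0" using L by (simp add: \<kappa>_def)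
  then have "\<kappa> * (n * \<gamma>) \<le> \<kappa> * 2" using n by (intro mult_left_mono) auto
  then show "exp (- (2 * \<kappa>)) \<le> exp (- (\<kappa> * \<gamma> * n))" by (simp add: ac_simps)
  have "1 / (4 * \<gamma>) \<le> pivot \<gamma>" using L by (simp add: pivot_def)
  then have "1 / (4 * \<gamma>) / (pi * n) \<le> pivot \<gamma> / (pi * n)" by (rule divide_right_mono) simp
  moreover have "1 / (8 * pi) \<le> 1 / (4 * \<gamma>) / (pi * n)"
    using n n0 \<gamma> by (simp add: field_simps)
  ultimately show "(1 / (8 * pi)) powr (real DIM('a) / 2) \<le> (pivot \<gamma> / (pi * n)) powr (real DIM('a) / 2)"
    by (intro powr_mono2) auto
  have "pivot \<gamma> / n \<le> 1 / 4 + L / 4"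
  proof -
    have "1 / (4 * (\<gamma> * n)) \<le> 1 / 4" using n n0 \<gamma> by (simp add: field_simps)
    moreover have "L / 4 / n \<le> L / 4" using divide_left_mono[of 1 "real n" "L / 4"] n0 L by simp
    moreover have "pivot \<gamma> / n = 1 / (4 * (\<gamma> * n)) + L / 4 / n"
      by (simp add: pivot_def add_divide_distrib)
    ultimately show ?thesis by linarith
  qed
  moreover have "(norm (y - x))\<^sup>2 \<le> 2 * X + 2"
  proof -
    have "(norm (y - x))\<^sup>2 \<le> (norm y + norm x)\<^sup>2" by (intro power_mono norm_triangle_ineq4) simp
    also have "\<dots> \<le> 2 * (norm y)\<^sup>2 + 2 * (norm x)\<^sup>2"
      using sum_squares_bound[of "norm y" "norm x"] by (simp add: power2_sum)
    finally show ?thesis using x y2 by simp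
  qed
  ultimately have "pivot \<gamma> / n * (norm (y - x))\<^sup>2 \<le> (1 / 4 + L / 4) * (2 * X + 2)"
    using L by (intro mult_mono) auto
  moreover have "n * pot \<gamma> * ((norm x)\<^sup>2 + (norm y)\<^sup>2) \<le> L\<^sup>2 / 2 * (X + 1)"
  proof (intro mult_mono add_mono x y2)
    have "(n * \<gamma>) * (L\<^sup>2 / 4) \<le> 2 * (L\<^sup>2 / 4)" using n by (intro mult_right_mono) auto
    then show "n * pot \<gamma> \<le> L\<^sup>2 / 2" by (simp add: pot_def mult.assoc)
  qed auto
  ultimately show "exp (- ((1 / 4 + L / 4) * (2 * X + 2) + L\<^sup>2 / 2 * (X + 1)))
      \<le> exp (- (pivot \<gamma> / n * (norm (y - x))\<^sup>2 + n * pot \<gamma> * ((norm x)\<^sup>2 + (norm y)\<^sup>2)))"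
    by simp
qed auto

lemma minorization:
  "\<exists>e>0. \<forall>\<gamma> n x A. \<gamma> > 0 \<longrightarrow> 1 \<le> n * \<gamma> \<longrightarrow> n * \<gamma> \<le> 2 \<longrightarrow> V x \<le> R \<longrightarrow> A \<in> sets borel \<longrightarrow>
     emeasure (density lborel (\<lambda>y. ennreal e * indicator (cball 0 1) y)) A
       \<le> emeasure (mala_iter U gradU \<gamma> n x) A"
proof -
  \<comment> \<open>The squared radius of the sublevel set V \<le> R.\<close>
  define X where "X = ln R / \<eta>"
  define e where "e = exp (- (L / 4 * (X + 1))) * (exp (- (2 * \<kappa>)) * (1 / (8 * pi)) powr (real DIM('a) / 2))
     * exp (- ((1 / 4 + L / 4) * (2 * X + 2) + L\<^sup>2 / 2 * (X + 1)))"
  have e: "e > 0" by (simp add: e_def)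
  have "emeasure (density lborel (\<lambda>y. ennreal e * indicator (cball 0 1) y)) A
       \<le> emeasure (mala_iter U gradU \<gamma> n x) A"
    if \<gamma>: "\<gamma> > 0" and n: "1 \<le> n * \<gamma>" "n * \<gamma> \<le> 2" and x: "V x \<le> R" and A [measurable]: "A \<in> sets borel" for \<gamma> n x A
  proof -
    interpret mala_chain U gradU \<gamma> by (rule mala_chain[OF \<gamma>])
    have n0: "n > 0" using n by (cases "n = 0") auto
    have "ln (V x) \<le> ln R" using x V_pos[of x] by simp
    then have xX: "(norm x)\<^sup>2 \<le> X" using \<eta>_pos by (simp add: X_def V_def field_simps)
    have "emeasure (density lborel (\<lambda>y. ennreal e * indicator (cball 0 1) y)) A
      = (\<integral>\<^sup>+y. ennreal e * indicator (cball 0 1) y * indicator A y \<partial>lborel)"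
    proof (rule emeasure_density)
      have [measurable]: "cball (0::'a) 1 \<in> sets borel" by simp
      show "(\<lambda>y::'a. ennreal e * indicator (cball 0 1) y) \<in> borel_measurable lborel" by measurable
    qed simp
    also have "\<dots> \<le> (\<integral>\<^sup>+y. indicator A y * ennreal (iter_lower \<gamma> n x y) \<partial>lborel)"
      using iter_lower_unit_time[OF \<gamma> n xX] unfolding e_def[symmetric]
      by (intro nn_integral_mono) (auto simp: indicator_def intro!: ennreal_leI)
    also have "\<dots> \<le> (\<integral>\<^sup>+y. indicator A y \<partial>iter n x)"
      by (rule nn_integral_iter_lower[OF \<gamma> n0 n(2)]) measurable
    also have "\<dots> = emeasure (iter n x) A" by simp
    finally show ?thesis .
  qed
  then show ?thesis using e by blast
qed

lemma unit_time_steps: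
  fixes \<gamma> :: real
  assumes \<gamma>: "small_step \<gamma>"
  obtains n :: nat where "n > 0" "1 \<le> n * \<gamma>" "n * \<gamma> \<le> 2" "(1 - \<gamma>) ^ n \<le> 1 / 2"
proof
  \<comment> \<open>Rounding up costs at most one step, that is \<gamma> \<le> 1 of physical time,
    whence n \<gamma> \<le> 2.\<close>
  define n where "n = nat \<lceil>1 / \<gamma>\<rceil>"
  have g: "0 < \<gamma>" "\<gamma> \<le> 1" using \<gamma> by (auto simp: small_step_def)
  have rn: "real n = of_int \<lceil>1 / \<gamma>\<rceil>" using g by (simp add: n_def)
  have "1 / \<gamma> \<le> real n" unfolding rn by (rule le_of_int_ceiling)
  then show 1: "1 \<le> n * \<gamma>" using g by (simp add: divide_le_eq)
  then show "n > 0" by (cases "n = 0") auto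
  have "real n \<le> 1 / \<gamma> + 1" unfolding rn by (rule of_int_ceiling_le_add_one)
  then have "n * \<gamma> \<le> (1 / \<gamma> + 1) * \<gamma>" using g by (intro mult_right_mono) auto
  also have "\<dots> = 1 + \<gamma>" using g by (simp add: field_simps)
  finally show "n * \<gamma> \<le> 2" using g by simp
  have "(1 - \<gamma>) ^ n \<le> exp (- \<gamma>) ^ n"
    using exp_ge_add_one_self[of "- \<gamma>"] g by (intro power_mono) auto
  also have "\<dots> = exp (- (n * \<gamma>))" by (simp flip: exp_of_nat_mult)
  also have "\<dots> \<le> exp (- 1)" using 1 by simp
  also have "\<dots> \<le> 1 / 2"
    using exp_ge_add_one_self[of "1::real"] by (simp add: exp_minus inverse_eq_divide field_simps)
  finally show "(1 - \<gamma>) ^ n \<le> 1 / 2" .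
qed

text \<open>The l steps outside the j blocks form the base case, where \<open>V_iter_le\<close>
  gives a bound uniform in l. Its factor 1 + Bdrift is divided by \<beta> to fit the weight \<beta>
  V.\<close>

lemma oscillation_decay:
  assumes \<gamma>: "small_step \<gamma>"
    and n: "n > 0" "(1 - \<gamma>) ^ n \<le> 1 / 2"
    and sets\<nu>: "sets \<nu> = sets borel"
    and minor: "\<And>x A. V x \<le> 8 * (Bdrift + 1) \<Longrightarrow> A \<in> sets borel \<Longrightarrow> emeasure \<nu> A \<le> emeasure (mala_iter U gradU \<gamma> n x) A"
    and mass: "ennreal \<epsilon> \<le> emeasure \<nu> UNIV"
    and \<beta>: "0 < \<beta>" "\<beta> \<le> 1 / 4" "2 * \<beta> * (Bdrift + 1) \<le> \<epsilon>"
    and f: "f \<in> borel_measurable borel" "\<And>x. \<bar>f x\<bar> \<le> V x"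
  shows "(\<integral>z. f z \<partial>mala_iter U gradU \<gamma> (j * n + l) x) - (\<integral>z. f z \<partial>mala_iter U gradU \<gamma> (j * n + l) y)
    \<le> (1 - \<beta>) ^ j * ((1 + Bdrift) / \<beta>) * (2 + \<beta> * V x + \<beta> * V y)"
proof (induction j arbitrary: x y)
  case 0
  interpret mala_chain U gradU \<gamma> using \<gamma> by (intro mala_chain) (simp add: small_step_def)
  have b: "\<bar>\<integral>z. f z \<partial>iter l x\<bar> \<le> (1 + Bdrift) * V x" for x
  proof -
    have "integrable (iter l x) f"
      using f V_pos by (intro Bochner_Integration.integrable_bound[OF V_iter(1)[OF \<gamma>]]) (auto simp: abs_of_pos)
    then have "\<bar>\<integral>z. f z \<partial>iter l x\<bar> \<le> (\<integral>z. V z \<partial>iter l x)"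
      using order_trans[OF integral_abs_bound integral_mono[OF integrable_abs V_iter(1)[OF \<gamma>] f(2)]] by blast
    also have "\<dots> \<le> V x + Bdrift * 1" using V_iter_le[OF \<gamma>] by simp
    also have "\<dots> \<le> V x + Bdrift * V x"
      using V_ge_1 Bdrift_nonneg by (intro add_left_mono mult_left_mono) auto
    finally show ?thesis by (simp add: algebra_simps)
  qed
  have "(\<integral>z. f z \<partial>iter l x) - (\<integral>z. f z \<partial>iter l y) \<le> (1 + Bdrift) * V x + (1 + Bdrift) * V y"
    using b[of x] b[of y] by (simp add: abs_le_iff)
  also have "\<dots> = ((1 + Bdrift) / \<beta>) * (\<beta> * V x + \<beta> * V y)" using \<beta> by (simp add: field_simps)
  also have "\<dots> \<le> ((1 + Bdrift) / \<beta>) * (2 + \<beta> * V x + \<beta> * V y)"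
    using \<beta> Bdrift_nonneg by (intro mult_left_mono) auto
  finally show ?case by simp
next
  case (Suc j)
  interpret mala_chain U gradU \<gamma> using \<gamma> by (intro mala_chain) (simp add: small_step_def)
  \<comment> \<open>The expectation of f after the remaining j n + l steps; the induction hypothesis
    is the oscillation bound that \<open>harris_contraction\<close> asks of it.\<close>
  define g where "g = (\<lambda>x. \<integral>z. f z \<partial>iter (j * n + l) x)"
  have fint: "integrable (iter k x) f" for k x
    using f V_pos by (intro Bochner_Integration.integrable_bound[OF V_iter(1)[OF \<gamma>]]) (auto simp: abs_of_pos)
  have gm: "g \<in> borel_measurable borel"
    unfolding g_def
    by (intro measurable_compose[OF subprob_measurable_iter integral_measurable_subprob_algebra] f)
  have split: "(\<integral>z. f z \<partial>iter (Suc j * n + l) x) = (\<integral>z. g z \<partial>iter n x)" for x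
  proof -
    have e: "Suc j * n + l = n + (j * n + l)" by simp
    have "iter (j * n + l) \<in> iter n x \<rightarrow>\<^sub>M subprob_algebra borel"
      using subprob_measurable_iter by (simp cong: measurable_cong_sets)
    from integral_bind_pointwise(2)[OF this f(1) fint[of "n + (j * n + l)" x, unfolded iter_add[of n]] fint]
    show ?thesis unfolding e iter_add[of n] g_def .
  qed
  have "(\<integral>z. g z \<partial>iter n x) - (\<integral>z. g z \<partial>iter n y)
      \<le> (1 - \<beta>) * ((1 - \<beta>) ^ j * ((1 + Bdrift) / \<beta>)) * (2 + \<beta> * V x + \<beta> * V y)"
  proof (rule harris_contraction[where M = borel and P = "iter n" and B = Bdrift and \<nu> = \<nu> and \<epsilon> = \<epsilon>])
    show "(\<integral>y. V y \<partial>iter n x) \<le> V x / 2 + Bdrift" for x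
    proof -
      have "(1 - \<gamma>) ^ n * V x \<le> 1 / 2 * V x" using n V_pos[of x] by (intro mult_right_mono) auto
      then show ?thesis using V_iter(2)[OF \<gamma>, of n x] by simp
    qed
    show "0 \<le> (1 - \<beta>) ^ j * ((1 + Bdrift) / \<beta>)" using \<beta> Bdrift_nonneg by simp
    show "g x - g y \<le> (1 - \<beta>) ^ j * ((1 + Bdrift) / \<beta>) * (2 + \<beta> * V x + \<beta> * V y)" for x y
      unfolding g_def by (rule Suc.IH)
  qed (use \<beta> mass minor sets\<nu> gm Bdrift_nonneg V_pos in \<open>auto intro: prob_space_iter V_iter(1)[OF \<gamma>] less_imp_le\<close>)
  then show ?case unfolding split by simp
qed

section \<open>Passage to the target and the rate in physical time\<close>

lemma target_V: "integrable (target U) V"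
  using nn_integral_target_V V_pos
  by (intro integrableI_nonneg) (auto intro: less_imp_le cong: measurable_cong_sets)

text \<open>The two-point bound is averaged over y distributed as the target, which the iterates
  preserve. Since V and its mean are at least 1, the constant 2 is absorbed into their sum.\<close>

lemma target_decay:
  assumes \<gamma>: "\<gamma> > 0"
    and f: "f \<in> borel_measurable borel" "\<And>x. \<bar>f x\<bar> \<le> V x"
    and int: "\<And>x. integrable (mala_iter U gradU \<gamma> k x) f"
    and osc: "\<And>x y. (\<integral>z. f z \<partial>mala_iter U gradU \<gamma> k x) - (\<integral>z. f z \<partial>mala_iter U gradU \<gamma> k y)
      \<le> q * (2 + \<beta> * V x + \<beta> * V y)"
    and q: "q \<ge> 0" and \<beta>: "0 < \<beta>" "\<beta> \<le> 1"
  shows "\<bar>(\<integral>z. f z \<partial>mala_iter U gradU \<gamma> k x) - (\<integral>z. f z \<partial>target U)\<bar> \<le> 2 * q * (V x + (\<integral>y. V y \<partial>target U))"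
proof -
  interpret mala_chain U gradU \<gamma> by (rule mala_chain[OF \<gamma>])
  interpret T: prob_space "target U" by (rule prob_space_target)
  define g where "g = (\<lambda>x. \<integral>z. f z \<partial>iter k x)"
  have "iter k \<in> target U \<rightarrow>\<^sub>M subprob_algebra borel"
    using subprob_measurable_iter by (simp cong: measurable_cong_sets)
  note b = integral_bind_pointwise[OF this f(1), unfolded target_bind_iter[OF prob_space_target]]
  have "integrable (target U) f"
    using f V_pos by (intro Bochner_Integration.integrable_bound[OF target_V]) (auto simp: abs_of_pos cong: measurable_cong_sets)
  then have gi: "integrable (target U) g" and gt: "(\<integral>z. f z \<partial>target U) = (\<integral>y. g y \<partial>target U)"
    using b int by (auto simp: g_def)
  have bnd: "q * (2 + \<beta> * V x + \<beta> * (\<integral>y. V y \<partial>target U)) \<le> 2 * q * (V x + (\<integral>y. V y \<partial>target U))"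
  proof -
    have 1: "1 \<le> (\<integral>y. V y \<partial>target U)"
    proof -
      have "(\<integral>y. 1 \<partial>target U) \<le> (\<integral>y. V y \<partial>target U)"
        using V_ge_1 by (intro integral_mono target_V) auto
      then show ?thesis by (simp add: T.prob_space)
    qed
    have "2 + \<beta> * V x + \<beta> * (\<integral>y. V y \<partial>target U) \<le> 2 + 1 * V x + 1 * (\<integral>y. V y \<partial>target U)"
      using \<beta> V_pos[of x] 1 by (intro add_mono mult_right_mono) auto
    also have "\<dots> \<le> 2 * (V x + (\<integral>y. V y \<partial>target U))"
      using V_ge_1[of x] 1 by simp
    finally have "2 + \<beta> * V x + \<beta> * (\<integral>y. V y \<partial>target U) \<le> 2 * (V x + (\<integral>y. V y \<partial>target U))" .
    from mult_left_mono[OF this q] show ?thesis by (simp add: ac_simps)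
  qed
  have W: "(\<integral>y. q * (2 + \<beta> * V x + \<beta> * V y) \<partial>target U) = q * (2 + \<beta> * V x + \<beta> * (\<integral>y. V y \<partial>target U))"
    using target_V by (simp add: T.prob_space)
  have Wi: "integrable (target U) (\<lambda>y. q * (2 + \<beta> * V x + \<beta> * V y))"
    using target_V by simp
  have "g x - (\<integral>y. g y \<partial>target U) = (\<integral>y. g x - g y \<partial>target U)"
    using gi by (simp add: T.prob_space)
  also have "\<dots> \<le> (\<integral>y. q * (2 + \<beta> * V x + \<beta> * V y) \<partial>target U)"
    using gi osc Wi by (intro integral_mono) (auto simp: g_def)
  finally have up: "g x - (\<integral>y. g y \<partial>target U) \<le> 2 * q * (V x + (\<integral>y. V y \<partial>target U))"
    using W bnd by linarith
  have "(\<integral>y. g y \<partial>target U) - g x = (\<integral>y. g y - g x \<partial>target U)"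
    using gi by (simp add: T.prob_space)
  also have "\<dots> \<le> (\<integral>y. q * (2 + \<beta> * V x + \<beta> * V y) \<partial>target U)"
    using gi osc[of _ x] Wi by (intro integral_mono) (auto simp: g_def algebra_simps)
  finally have "(\<integral>y. g y \<partial>target U) - g x \<le> 2 * q * (V x + (\<integral>y. V y \<partial>target U))"
    using W bnd by linarith
  with up show ?thesis by (simp add: gt g_def abs_le_iff)
qed

text \<open>A block lasts at most 2 units of time, so k steps contain at least \<gamma> k / 2 - 1
  complete blocks: hence the square root of \<theta>, and the factor 1 / \<theta> for the incomplete
  block.\<close>

lemma geometric_rate:
  assumes "0 < \<theta>" "\<theta> < 1" "n > 0" "n * \<gamma> \<le> 2" "\<gamma> > 0"
  shows "\<theta> ^ (k div n) \<le> (1 / \<theta>) * (\<theta> powr (1 / 2)) powr (\<gamma> * real k)"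
proof -
  have "real k \<le> real (k div n) * n + n"
    using assms(3) by (metis add_left_mono div_mult_mod_eq less_imp_le mod_less_divisor of_nat_add of_nat_le_iff of_nat_mult)
  then have "\<gamma> * k \<le> \<gamma> * (real (k div n) * n + n)" using assms by (intro mult_left_mono) auto
  also have "\<dots> = (n * \<gamma>) * (real (k div n) + 1)" by (simp add: algebra_simps)
  also have "\<dots> \<le> 2 * (real (k div n) + 1)" using assms by (intro mult_right_mono) auto
  finally have "\<gamma> * k / 2 - 1 \<le> real (k div n)" by simp
  then have "\<theta> powr (real (k div n)) \<le> \<theta> powr (\<gamma> * k / 2 - 1)"
    using assms by (intro powr_mono') auto
  also have "\<dots> = (1 / \<theta>) * (\<theta> powr (1 / 2)) powr (\<gamma> * real k)"
    using assms by (simp add: powr_diff powr_powr)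
  finally show ?thesis using assms by (simp add: powr_realpow)
qed

lemma geometric_ergodicity:
  "\<exists>C\<ge>0. \<exists>\<rho>. 0 \<le> \<rho> \<and> \<rho> < 1 \<and> (\<forall>x \<gamma> k. small_step \<gamma> \<longrightarrow>
     vnorm V (mala_iter U gradU \<gamma> k x) (target U)
       \<le> ereal (C * \<rho> powr (\<gamma> * real k) * (V x + (\<integral>y. V y \<partial>target U))))"
proof -
  obtain e where e: "e > 0" and minor: "\<And>\<gamma> n x A. \<gamma> > 0 \<Longrightarrow> 1 \<le> real n * \<gamma> \<Longrightarrow> n * \<gamma> \<le> 2 \<Longrightarrow>
     V x \<le> 8 * (Bdrift + 1) \<Longrightarrow> A \<in> sets borel \<Longrightarrow>
     emeasure (density lborel (\<lambda>y. ennreal e * indicator (cball 0 1) y)) A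
       \<le> emeasure (mala_iter U gradU \<gamma> n x) A"
    using minorization[of "8 * (Bdrift + 1)"] by blast
  define \<nu> where "\<nu> = density lborel (\<lambda>y::'a. ennreal e * indicator (cball 0 1) y)"
  define \<epsilon> where "\<epsilon> = e * measure lborel (cball (0::'a) 1)"
  have \<epsilon>: "\<epsilon> > 0" using e content_cball_pos[of 1 "0::'a"] by (simp add: \<epsilon>_def)
  have mass: "ennreal \<epsilon> \<le> emeasure \<nu> UNIV"
  proof -
    have [measurable]: "cball (0::'a) 1 \<in> sets borel" by simp
    have "emeasure \<nu> UNIV = ennreal e * emeasure lborel (cball (0::'a) 1)"
      unfolding \<nu>_def by (subst emeasure_density) (auto simp: nn_integral_cmult)
    also have "emeasure lborel (cball (0::'a) 1) = ennreal (measure lborel (cball (0::'a) 1))"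
      by (rule emeasure_eq_ennreal_measure) (use emeasure_lborel_cball_finite[of "0::'a" 1] in auto)
    finally show ?thesis using e by (simp add: \<epsilon>_def ennreal_mult)
  qed
  \<comment> \<open>The minimum meets the two upper bounds on \<beta> in
    \<open>harris_contraction\<close>. Neither \<epsilon> nor \<open>Bdrift\<close> depends on
    \<gamma>, hence neither does \<beta>.\<close>
  define \<beta> where "\<beta> = min (1 / 4) (\<epsilon> / (2 * (Bdrift + 1)))"
  have \<beta>: "0 < \<beta>" "\<beta> \<le> 1 / 4"
    unfolding \<beta>_def using \<epsilon> Bdrift_nonneg by simp (rule min.cobounded1)
  have "\<beta> \<le> \<epsilon> / (2 * (Bdrift + 1))" by (simp add: \<beta>_def)
  then have \<beta>': "2 * \<beta> * (Bdrift + 1) \<le> \<epsilon>" using Bdrift_nonneg by (simp add: field_simps)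
  define c where "c = (1 + Bdrift) / \<beta>"
  have c: "c \<ge> 0" using \<beta> Bdrift_nonneg by (simp add: c_def)
  define \<theta> where "\<theta> = 1 - \<beta>"
  have \<theta>: "0 < \<theta>" "\<theta> < 1" using \<beta> by (auto simp: \<theta>_def)
  define C where "C = 2 * c / \<theta>"
  define \<rho> where "\<rho> = \<theta> powr (1 / 2)"
  have bound: "vnorm V (mala_iter U gradU \<gamma> k x) (target U)
       \<le> ereal (C * \<rho> powr (\<gamma> * real k) * (V x + (\<integral>y. V y \<partial>target U)))"
    if \<gamma>: "small_step \<gamma>" for x \<gamma> k
  proof -
    have g: "\<gamma> > 0" using \<gamma> by (simp add: small_step_def)
    interpret mala_chain U gradU \<gamma> by (rule mala_chain[OF g])
    obtain n :: nat where n: "n > 0" "1 \<le> n * \<gamma>" "n * \<gamma> \<le> 2" "(1 - \<gamma>) ^ n \<le> 1 / 2"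
      using unit_time_steps[OF \<gamma>] by blast
    have Vint: "0 \<le> (\<integral>y. V y \<partial>target U)" using V_pos by (intro integral_nonneg_AE) (auto intro: less_imp_le)
    have "\<bar>(\<integral>z. f z \<partial>iter k x) - (\<integral>z. f z \<partial>target U)\<bar>
        \<le> C * \<rho> powr (\<gamma> * real k) * (V x + (\<integral>y. V y \<partial>target U))"
      if f: "f \<in> borel_measurable borel" "\<And>x. \<bar>f x\<bar> \<le> V x" for f
    proof -
      have k: "(k div n) * n + k mod n = k" by simp
      have osc: "(\<integral>z. f z \<partial>iter k x) - (\<integral>z. f z \<partial>iter k y) \<le> (\<theta> ^ (k div n) * c) * (2 + \<beta> * V x + \<beta> * V y)" for x y
        using oscillation_decay[OF \<gamma> n(1,4) _ _ mass \<beta> \<beta>' f, of "k div n" "k mod n" x y]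
          minor[OF g n(2,3)]
        unfolding k \<theta>_def c_def by (simp add: \<nu>_def)
      have int: "integrable (iter k x) f" for x
        using f V_pos by (intro Bochner_Integration.integrable_bound[OF V_iter(1)[OF \<gamma>]]) (auto simp: abs_of_pos)
      have "\<bar>(\<integral>z. f z \<partial>iter k x) - (\<integral>z. f z \<partial>target U)\<bar>
          \<le> 2 * (\<theta> ^ (k div n) * c) * (V x + (\<integral>y. V y \<partial>target U))"
        using \<theta> c \<beta> by (intro target_decay[OF g f int osc]) auto
      also have "\<dots> \<le> 2 * (((1 / \<theta>) * \<rho> powr (\<gamma> * real k)) * c) * (V x + (\<integral>y. V y \<partial>target U))"
        unfolding \<rho>_def using c V_pos[of x] Vint
        by (intro mult_right_mono mult_left_mono geometric_rate \<theta> n g) auto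
      also have "\<dots> = C * \<rho> powr (\<gamma> * real k) * (V x + (\<integral>y. V y \<partial>target U))"
        by (simp add: C_def ac_simps)
      finally show ?thesis .
    qed
    \<comment> \<open>\<open>vnorm\<close> is \<infinity> unless V is integrable under both
      measures, so this has to be supplied besides the bound on test functions.\<close>
    then show ?thesis
      unfolding vnorm_def using V_iter(1)[OF \<gamma>] target_V
      by (auto intro!: SUP_least)
  qed
  show ?thesis
  proof (intro exI conjI allI impI)
    show "0 \<le> C" using c \<theta> by (simp add: C_def)
    show "\<rho> < 1" using \<theta> powr_less_mono2[of "1/2" \<theta> 1] by (simp add: \<rho>_def)
    show "0 \<le> \<rho>" by (simp add: \<rho>_def)
  qed (rule bound)
qed

end

theorem theorem2:
  fixes U :: "'a::euclidean_space \<Rightarrow> real"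
    and gradU :: "'a \<Rightarrow> 'a"
    and H :: "'a \<Rightarrow> ('a \<Rightarrow>\<^sub>L 'a)"
    and T :: "'a \<Rightarrow> ('a \<Rightarrow>\<^sub>L ('a \<Rightarrow>\<^sub>L 'a))"
    and L M m K :: real
  assumes grad: "\<And>x. (U has_derivative (\<lambda>h. gradU x \<bullet> h)) (at x)"
    and hess: "\<And>x. (gradU has_derivative blinfun_apply (H x)) (at x)"
    and hess_cont: "continuous_on UNIV H"
    and grad0: "gradU 0 = 0"
    and L: "L \<ge> 0" "\<And>x. norm (H x) \<le> L"
    and third: "\<And>x. (H has_derivative blinfun_apply (T x)) (at x)"
    and third_cont: "continuous_on UNIV T"
    and M: "M \<ge> 0" "\<And>x. norm (T x) \<le> M"
    and m: "m > 0" and K: "K \<ge> 0"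
    and convex: "\<And>x y. norm x \<ge> K \<Longrightarrow> norm y = 1 \<Longrightarrow> (H x y) \<bullet> y \<ge> m"
  defines "V \<equiv> (\<lambda>x::'a. exp ((m / 16) * (norm x)\<^sup>2))"
  shows "\<exists>\<Gamma>>0. \<exists>A>0. (\<integral>\<^sup>+ x. ennreal (V x) \<partial>target U) \<le> ennreal A \<and>
           (\<forall>\<gamma>b \<in> {0<..\<Gamma>}. \<exists>C \<ge> 0. \<exists>\<rho>. 0 \<le> \<rho> \<and> \<rho> < 1 \<and>
              (\<forall>x. \<forall>\<gamma> \<in> {0<..\<gamma>b}. \<forall>k::nat.
                 vnorm V (mala_iter U gradU \<gamma> k x) (target U)
                   \<le> ereal (C * \<rho> powr (\<gamma> * real k) * (V x + (\<integral>y. V y \<partial>target U)))))"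
proof -
  interpret S: smooth_potential U gradU H L m K
    by unfold_locales (fact grad hess grad0 L m K convex)+
  have V: "V = S.V" unfolding V_def S.V_def S.\<eta>_def ..
  obtain \<Gamma> where \<Gamma>: "\<Gamma> > 0" "\<And>\<gamma>. \<gamma> \<in> {0<..\<Gamma>} \<Longrightarrow> S.small_step \<gamma>"
    using S.ex_small_step by blast
  obtain C \<rho> where C: "C \<ge> 0" "0 \<le> \<rho>" "\<rho> < 1" and
    bound: "\<And>x \<gamma> k. S.small_step \<gamma> \<Longrightarrow> vnorm S.V (mala_iter U gradU \<gamma> k x) (target U)
       \<le> ereal (C * \<rho> powr (\<gamma> * real k) * (S.V x + (\<integral>y. S.V y \<partial>target U)))"
    using S.geometric_ergodicity by blast
  define A where "A = enn2real (\<integral>\<^sup>+ x. ennreal (S.V x) \<partial>target U) + 1"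
  have A: "A > 0" by (simp add: A_def add_nonneg_pos)
  have le: "(\<integral>\<^sup>+ x. ennreal (S.V x) \<partial>target U) \<le> ennreal A"
  proof -
    have "(\<integral>\<^sup>+ x. ennreal (S.V x) \<partial>target U) = ennreal (enn2real (\<integral>\<^sup>+ x. ennreal (S.V x) \<partial>target U))"
      using S.nn_integral_target_V by simp
    also have "\<dots> \<le> ennreal A" by (rule ennreal_leI) (simp add: A_def)
    finally show ?thesis .
  qed
  \<comment> \<open>The constants C and \<rho> are uniform over all steps in (0, \<Gamma>], so the
    same pair is used for every \<gamma>b.\<close>
  have "vnorm S.V (mala_iter U gradU \<gamma> k x) (target U)
      \<le> ereal (C * \<rho> powr (\<gamma> * real k) * (S.V x + (\<integral>y. S.V y \<partial>target U)))"
    if "\<gamma>b \<in> {0<..\<Gamma>}" "\<gamma> \<in> {0<..\<gamma>b}" for \<gamma>b \<gamma> x and k :: nat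
    using that by (intro bound \<Gamma>(2)) auto
  with \<Gamma>(1) A le C show ?thesis
    unfolding V by blast
qed

end
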